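(* Let $H\in\{S_{1,1,3}, S_{1,2,3}\}$ and let $G$ be a connected graph that is $(\mathrm{bull}, C_5, H)$-free, i.e. $G$ contains none of the bull, the $5$-cycle $C_5$, and $H$ as an induced subgraph. Then at least one of the following holds: (i) $G$ contains an odd wheel; (ii) $G$ contains a (not necessarily induced) spindle graph $M_{3i+1}$ for some $i\geq 1$, i.e. $G$ has a subgraph isomorphic to $M_{3i+1}$; (iii) $G$ is $3$-colourable.
   Context: All graphs are finite, simple and undirected. The bull is the graph on vertices $v_1,\dots,v_5$ with edges $v_1v_2, v_2v_3, v_3v_4, v_4v_5, v_2v_4$. For integers $i,j,k\ge 1$, $S_{i,j,k}$ is the graph consisting of three induced paths of lengths $i$, $j$ and $k$ sharing a common initial vertex and otherwise disjoint, with no further edges. An odd wheel $W_{2t+1}$ ($t\ge 1$) is the graph obtained from a cycle of length $2t+1$ by adding a vertex adjacent to all vertices of the cycle. For $p\ge 1$, a spindle graph $M_{3p+1}$ is a graph of order $3p+1$ containing a cycle $u_0u_1\cdots u_{3p}u_0$ (indices modulo $3p+1$) such that for each $i\in\{1,\dots,p\}$ one has $N(u_{3i})=\{u_{3i-2},u_{3i-1},u_{3i+1},u_{3i+2}\}$ and $N(u_{3i-1})\cap N(u_{3i-2})=\{u_{3i-3},u_{3i}\}$. (E.g. $M_4\cong K_4$, $M_7$ is the Moser spindle.)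
   Formalization: In the spindle graph M_{3p+1}, the neighbourhood of the last vertex u_{3p} is taken as {u_{3p-2}, u_{3p-1}, u_0}, without u_{3p+2}=u_1; the literal formula contradicts M_7 being the Moser spindle and makes the claim false. *)

theory Defs
  imports "Graph_Theory.Graph_Theory"
begin

text \<open>
  A finite simple undirected graph is a \<open>pair_graph\<close>: a finite vertex set with a symmetric and
  irreflexive arc set, every edge being represented by its two arcs.
\<close>

definition ugraph :: "'a set \<Rightarrow> ('a \<times> 'a) set \<Rightarrow> 'a pair_pre_digraph" where
  "ugraph V E = \<lparr> pverts = V, parcs = E \<union> E\<inverse> \<rparr>"

definition nbrs :: "'a pair_pre_digraph \<Rightarrow> 'a \<Rightarrow> 'a set" where
  "nbrs G v = {w. (v, w) \<in> parcs G}"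

definition contains_induced :: "'a pair_pre_digraph \<Rightarrow> 'b pair_pre_digraph \<Rightarrow> bool" where
  "contains_induced G F \<longleftrightarrow>
    (\<exists>K. induced_subgraph K (with_proj G) \<and> digraph_iso (with_proj F) K)"

definition colourable :: "nat \<Rightarrow> 'a pair_pre_digraph \<Rightarrow> bool" where
  "colourable k G \<longleftrightarrow>
    (\<exists>c :: 'a \<Rightarrow> nat. (\<forall>v \<in> pverts G. c v < k) \<and> (\<forall>(u, v) \<in> parcs G. c u \<noteq> c v))"

definition bull :: "nat pair_pre_digraph" where
  "bull = ugraph {1..5} {(1, 2), (2, 3), (3, 4), (4, 5), (2, 4)}"

text \<open>The cycle and the wheel below are meant for \<open>n \<ge> 3\<close>.\<close>

definition cycle_graph :: "nat \<Rightarrow> nat pair_pre_digraph" where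
  "cycle_graph n = ugraph {..<n} {(i, (i + 1) mod n) | i. i < n}"

text \<open>The graph $S_{i,j,k}$: the centre is \<open>(0, 0)\<close> and the vertex at distance \<open>m \<ge> 1\<close> from the
  centre on leg \<open>a \<in> {1, 2, 3}\<close> is \<open>(a, m)\<close>.\<close>

definition S_graph :: "nat \<Rightarrow> nat \<Rightarrow> nat \<Rightarrow> (nat \<times> nat) pair_pre_digraph" where
  "S_graph i j k =
    (let L = {(a, m). (a = 1 \<and> 1 \<le> m \<and> m \<le> i) \<or> (a = 2 \<and> 1 \<le> m \<and> m \<le> j)
                    \<or> (a = 3 \<and> 1 \<le> m \<and> m \<le> k)}
     in ugraph (insert (0, 0) L)
          ({((0, 0), (a, 1)) | a. (a, 1) \<in> L} \<union>
           {((a, m), (a, m + 1)) | a m. (a, m) \<in> L \<and> (a, m + 1) \<in> L}))"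

text \<open>The wheel over a cycle of length \<open>n\<close>, with hub \<open>None\<close>.\<close>

definition wheel :: "nat \<Rightarrow> nat option pair_pre_digraph" where
  "wheel n = ugraph (insert None (Some ` {..<n}))
     ({(Some i, Some ((i + 1) mod n)) | i. i < n} \<union> {(None, Some i) | i. i < n})"

text \<open>
  \<open>spindle p M\<close>: the graph \<open>M\<close> is a spindle graph $M_{3p+1}$ along a Hamiltonian cycle
  $u_0 u_1 \dots u_{3p}$. The usual shorthand
  $N(u_{3i}) = \{u_{3i-2}, u_{3i-1}, u_{3i+1}, u_{3i+2}\}$ is meant with indices modulo
  \<open>3 * p + 1\<close>, except that the last vertex of the chain, $u_{3p}$, has no neighbour
  $u_{3p+2} = u_1$ besides its listed ones: $N(u_{3p}) = \{u_{3p-2}, u_{3p-1}, u_0\}$.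
  (For \<open>p = 1\<close> this makes no difference, as $u_{3p-2} = u_1$.)
  With the additional edge $u_{3p} u_1$ for \<open>p = 2\<close>, the graph would have at least 12 edges and
  two vertices of degree at least 4, and so would not be the Moser spindle.
\<close>

definition spindle :: "nat \<Rightarrow> 'a pair_pre_digraph \<Rightarrow> bool" where
  "spindle p M \<longleftrightarrow>
    1 \<le> p \<and> pair_graph M \<and> card (pverts M) = 3 * p + 1 \<and>
    (\<exists>u :: nat \<Rightarrow> 'a.
      inj_on u {..3 * p} \<and> u ` {..3 * p} \<subseteq> pverts M \<and>
      (\<forall>i \<le> 3 * p. (u i, u ((i + 1) mod (3 * p + 1))) \<in> parcs M) \<and>
      (\<forall>i \<in> {1..p}.
         nbrs M (u (3 * i)) =
           {u (3 * i - 2), u (3 * i - 1), u ((3 * i + 1) mod (3 * p + 1))} \<union>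
           (if i < p then {u (3 * i + 2)} else {}) \<and>
         nbrs M (u (3 * i - 1)) \<inter> nbrs M (u (3 * i - 2)) = {u (3 * i - 3), u (3 * i)}))"

definition contains_odd_wheel :: "'a pair_pre_digraph \<Rightarrow> bool" where
  "contains_odd_wheel G \<longleftrightarrow> (\<exists>t \<ge> 1. contains_induced G (wheel (2 * t + 1)))"

definition contains_spindle :: "'a pair_pre_digraph \<Rightarrow> bool" where
  "contains_spindle G \<longleftrightarrow>
    (\<exists>i \<ge> 1. \<exists>M :: 'a pair_pre_digraph. subgraph (with_proj M) (with_proj G) \<and> spindle i M)"

lemma contains_induced_iff_embedding:
  assumes "pair_wf_digraph G" "pair_wf_digraph F"
  shows "contains_induced G F \<longleftrightarrow>
    (\<exists>f. inj_on f (pverts F) \<and> f ` pverts F \<subseteq> pverts G \<and>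
      (\<forall>u \<in> pverts F. \<forall>v \<in> pverts F. (u, v) \<in> parcs F \<longleftrightarrow> (f u, f v) \<in> parcs G))"
    (is "?L \<longleftrightarrow> ?R")
proof
  interpret F: pair_wf_digraph F by (fact assms(2))
  interpret G: pair_wf_digraph G by (fact assms(1))
  assume ?L
  then obtain K h where K: "induced_subgraph K (with_proj G)"
    and h: "pre_digraph.digraph_isomorphism (with_proj F) h" "K = app_iso h (with_proj F)"
    unfolding contains_induced_def digraph_iso_def by blast
  define f where "f = iso_verts h"
  have inj: "inj_on f (pverts F)"
    and ends: "\<And>a. a \<in> parcs F \<Longrightarrow>
      f (fst a) = iso_tail h (iso_arcs h a) \<and> f (snd a) = iso_head h (iso_arcs h a)"
    using h(1) by (auto simp: pre_digraph.digraph_isomorphism_def f_def)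
  have KV: "verts K = f ` pverts F" and KA: "arcs K = iso_arcs h ` parcs F"
    and KT: "tail K = iso_tail h" and KH: "head K = iso_head h"
    by (auto simp: h(2) f_def)
  have sub: "f ` pverts F \<subseteq> pverts G"
    and ind: "arcs K = {e \<in> parcs G. fst e \<in> f ` pverts F \<and> snd e \<in> f ` pverts F}"
    and comp: "tail K = fst" "head K = snd"
    using K by (auto simp: induced_subgraph_def subgraph_def compatible_def KV)
  have "(u, v) \<in> parcs F \<longleftrightarrow> (f u, f v) \<in> parcs G" if uv: "u \<in> pverts F" "v \<in> pverts F" for u v
  proof
    assume a: "(u, v) \<in> parcs F"
    then have "iso_arcs h (u, v) \<in> arcs K" by (simp add: KA)
    then have "iso_arcs h (u, v) \<in> parcs G" using ind by blast
    moreover have "iso_arcs h (u, v) = (f u, f v)"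
      using ends[OF a] comp KT KH by (simp add: prod_eq_iff)
    ultimately show "(f u, f v) \<in> parcs G" by simp
  next
    assume "(f u, f v) \<in> parcs G"
    then have "(f u, f v) \<in> arcs K" using uv ind by auto
    then obtain a where a: "a \<in> parcs F" "iso_arcs h a = (f u, f v)" unfolding KA by force
    then have "f (fst a) = f u" "f (snd a) = f v" using ends[OF a(1)] comp KT KH by auto
    then have "fst a = u" "snd a = v"
      using inj uv a(1) F.arc_fst_in_verts F.arc_snd_in_verts by (auto dest: inj_onD)
    then show "(u, v) \<in> parcs F" using a(1) by (metis prod.collapse)
  qed
  then show ?R using inj sub by blast
next
  interpret F: pair_wf_digraph F by (fact assms(2))
  interpret G: pair_wf_digraph G by (fact assms(1))
  assume ?R
  then obtain f where inj: "inj_on f (pverts F)" and sub: "f ` pverts F \<subseteq> pverts G"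
    and E: "\<And>u v. u \<in> pverts F \<Longrightarrow> v \<in> pverts F \<Longrightarrow> (u, v) \<in> parcs F \<longleftrightarrow> (f u, f v) \<in> parcs G"
    by blast
  define h where "h = \<lparr> iso_verts = f, iso_arcs = map_prod f f, iso_head = snd, iso_tail = fst \<rparr>"
  have "inj_on (map_prod f f) (pverts F \<times> pverts F)"
    using inj by (simp add: map_prod_inj_on)
  moreover have "parcs F \<subseteq> pverts F \<times> pverts F"
    using F.in_arcsD1 F.in_arcsD2 by auto
  ultimately have "inj_on (map_prod f f) (parcs F)" by (rule inj_on_subset)
  then have iso: "pre_digraph.digraph_isomorphism (with_proj F) h"
    using inj F.wf_digraph by (auto simp: pre_digraph.digraph_isomorphism_def h_def)
  have arcs: "map_prod f f ` parcs F = {e \<in> parcs G. fst e \<in> f ` pverts F \<and> snd e \<in> f ` pverts F}"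
  proof (intro set_eqI iffI)
    fix e assume "e \<in> map_prod f f ` parcs F"
    then obtain u v where uv: "(u, v) \<in> parcs F" and e: "e = (f u, f v)" by auto
    then show "e \<in> {e \<in> parcs G. fst e \<in> f ` pverts F \<and> snd e \<in> f ` pverts F}"
      using E[of u v] F.in_arcsD1[OF uv] F.in_arcsD2[OF uv] by simp
  next
    fix e assume "e \<in> {e \<in> parcs G. fst e \<in> f ` pverts F \<and> snd e \<in> f ` pverts F}"
    then obtain u v where uv: "u \<in> pverts F" "v \<in> pverts F" and e: "e = (f u, f v)" "e \<in> parcs G"
      by (cases e) auto
    then have "(u, v) \<in> parcs F" using E by simp
    then show "e \<in> map_prod f f ` parcs F" using e(1) by (metis imageI map_prod_simp)
  qed
  have wf: "wf_digraph (app_iso h (with_proj F))"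
    by unfold_locales (auto simp: h_def dest: F.in_arcsD1 F.in_arcsD2)
  have "induced_subgraph (app_iso h (with_proj F)) (with_proj G)"
    using sub arcs wf G.wf_digraph
    by (auto simp: induced_subgraph_def subgraph_def compatible_def h_def)
  then show ?L unfolding contains_induced_def digraph_iso_def using iso by blast
qed

end

theory Submission
  imports Defs
begin

text \<open>
  Since $S_{1,1,3}$ is an induced subgraph of $S_{1,2,3}$, it suffices to exclude $S_{1,2,3}$. Let
  \<open>U\<close> be a minimal set of vertices that is not 3-colourable.

  An induced prism in a bull-free graph without spindles dominates \<open>U\<close> and yields a 3-colouring.
  A shortest odd hole has length at least 7, and $U$ arises from it by replacing each vertex by a
  bipartite module; the number and the position of the modules with an edge decide between a spindle
  and a 3-colouring. So every triangle-free subset of \<open>U\<close> is bipartite, and \<open>U\<close> behaves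
  like a minimal imperfect graph: an independent set meeting all triangles would give a 3-colouring.
  This excludes star cutsets and vertices with complete bipartite neighbourhood.

  For a vertex \<open>v\<close>, consider a non-neighbour \<open>d\<close> with the maximal number of neighbours among
  the non-isolated vertices \<open>N'\<close> of the neighbourhood of \<open>v\<close>. In a 3-colouring of the other
  vertices, \<open>N'\<close> uses all colours, so \<open>d\<close> misses some \<open>y\<close> in \<open>N'\<close>; comparing \<open>d\<close> with
  a suitable neighbour of \<open>y\<close> (as in Hayward's proof that weakly chordal graphs are perfect) leads
  to a prism or a Moser spindle.
\<close>

subsection \<open>Odd holes in non-bipartite graphs\<close>

text \<open>The hypotheses meet at a shortest odd hole. A vertex complete to it is the hub of an odd
  wheel, a vertex with exactly one neighbour on it gives an S_{1,2,3}, and for any other vertex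
  attached to it bulls or the minimality of the hole force the position of a twin of some hole
  vertex. This is where the modules come from. As K_4 is excluded, consecutive modules cannot both
  contain an edge. If on a hole of length 2p+1 every second module does, each such edge and the two
  hole vertices beside it form a diamond, and the chain of p diamonds is closed by the last hole
  edge: this is M_{3p+1}, and the reason why spindles of every length must be excluded. Elsewhere
  only M_4 and M_7 occur. Since cliques have at most three vertices, bipartiteness of the
  triangle-free sets takes the place of perfection of the proper subgraphs. No neighbourhood is
  complete bipartite, because any two of the three colours of the remaining graph occur on an edge
  in it. Hence there are nonadjacent vertices in it that are not twins, and the last part shows such
  a pair to be twins after all.\<close>

definition col_on :: "('a \<Rightarrow> 'a \<Rightarrow> bool) \<Rightarrow> nat \<Rightarrow> 'a set \<Rightarrow> bool" where
  "col_on E k S \<longleftrightarrow> (\<exists>f. (\<forall>x\<in>S. f x < k) \<and> (\<forall>x\<in>S. \<forall>y\<in>S. E x y \<longrightarrow> f x \<noteq> f y))"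

text \<open>A hole of length \<open>n\<close> is indexed periodically by the integers.\<close>

definition hole :: "('a \<Rightarrow> 'a \<Rightarrow> bool) \<Rightarrow> int \<Rightarrow> (int \<Rightarrow> 'a) \<Rightarrow> bool" where
  "hole E n c \<longleftrightarrow> (\<forall>i j. c i = c j \<longleftrightarrow> n dvd i - j) \<and>
    (\<forall>i j. E (c i) (c j) \<longleftrightarrow> n dvd i - j - 1 \<or> n dvd i - j + 1)"

lemma sym_relpow: "sym r \<Longrightarrow> (a, b) \<in> r ^^ k \<Longrightarrow> (b, a) \<in> r ^^ k"
proof (induction k arbitrary: b)
  case (Suc k)
  then obtain c where "(a, c) \<in> r ^^ k" "(c, b) \<in> r" by auto
  then have "(c, a) \<in> r ^^ k" "(b, c) \<in> r" using Suc by (auto dest: symD)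
  then show ?case by (rule relpow_Suc_I2[rotated])
qed auto

text \<open>Colour each vertex by the parity of some walk from the representative of its component.
  This fails on some edge, and the walks to its two ends close up with it to odd length.\<close>

lemma odd_closed_walk:
  assumes "\<not> col_on E 2 S" and sym: "\<And>x y. E x y \<Longrightarrow> E y x"
  obtains x n where "odd n" "(x, x) \<in> {(a, b). a \<in> S \<and> b \<in> S \<and> E a b} ^^ n"
proof -
  define r where "r = {(a, b). a \<in> S \<and> b \<in> S \<and> E a b}"
  have sy: "sym r" using sym unfolding r_def by (auto intro: symI)
  define root where "root x = (SOME y. (x, y) \<in> r\<^sup>*)" for x
  define f :: "_ \<Rightarrow> nat" where "f x = (if \<exists>k. even k \<and> (root x, x) \<in> r ^^ k then 0 else 1)" for x
  have root: "\<exists>k. (root x, x) \<in> r ^^ k" for x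
  proof -
    have "(x, root x) \<in> r\<^sup>*" unfolding root_def by (rule someI[of _ x]) simp
    then show ?thesis using sym_relpow[OF sy] rtrancl_power by blast
  qed
  have same: "root x = root y" if "(x, y) \<in> r" for x y
  proof -
    have "(y, x) \<in> r" using that sy by (meson symD)
    then have "(x, z) \<in> r\<^sup>* \<longleftrightarrow> (y, z) \<in> r\<^sup>*" for z
      using that by (meson converse_rtrancl_into_rtrancl)
    then show ?thesis by (simp add: root_def)
  qed
  have par: "\<exists>k. (root x, x) \<in> r ^^ k \<and> (even k \<longleftrightarrow> f x = 0)" for x
    using root[of x] unfolding f_def by (cases "\<exists>k. even k \<and> (root x, x) \<in> r ^^ k") auto
  have f2: "f x < 2" for x by (simp add: f_def)
  have "\<exists>x\<in>S. \<exists>y\<in>S. E x y \<and> f x = f y"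
    using assms(1) f2 unfolding col_on_def by blast
  then obtain x y where xy: "(x, y) \<in> r" "f x = f y" unfolding r_def by blast
  obtain k where k: "(root x, x) \<in> r ^^ k" "even k \<longleftrightarrow> f x = 0" using par by blast
  obtain l where l': "(root y, y) \<in> r ^^ l" "even l \<longleftrightarrow> f y = 0" using par by blast
  note l = l'[folded same[OF xy(1)] xy(2)]
  have "(root x, y) \<in> r ^^ Suc k" using k(1) xy(1) by (rule relpow_Suc_I)
  moreover have "(y, root x) \<in> r ^^ l" using sym_relpow[OF sy l(1)] .
  ultimately have "(root x, root x) \<in> r ^^ (Suc k + l)" unfolding relpow_add by (rule relcompI)
  moreover have "odd (Suc k + l)" using k(2) l(2) by auto
  ultimately show ?thesis using that unfolding r_def by blast
qed

text \<open>A shortest odd closed walk is an induced cycle: a repeated vertex or a chord would split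
  it into two closed walks, one of them odd and shorter.\<close>

lemma odd_hole_exists:
  assumes "\<not> col_on E 2 S" and sym: "\<And>x y. E x y \<Longrightarrow> E y x" and irrefl: "\<And>x. \<not> E x x"
    and tri: "\<And>x y z. x \<in> S \<Longrightarrow> y \<in> S \<Longrightarrow> z \<in> S \<Longrightarrow> E x y \<Longrightarrow> E y z \<Longrightarrow> \<not> E x z"
  obtains n c where "odd n" "n \<ge> 5" "hole E n c" "range c \<subseteq> S"
proof -
  define r where "r = {(a, b). a \<in> S \<and> b \<in> S \<and> E a b}"
  have sy: "sym r" using sym unfolding r_def by (auto intro: symI)
  define P where "P n \<longleftrightarrow> odd n \<and> (\<exists>x. (x, x) \<in> r ^^ n)" for n
  define m where "m = (LEAST n. P n)"
  have "\<exists>n. P n" unfolding P_def r_def by (rule odd_closed_walk[OF assms(1) sym]) blast+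
  then have "P m" unfolding m_def by (rule LeastI_ex)
  have least: "m \<le> k" if "odd k" "(x, x) \<in> r ^^ k" for k x
    unfolding m_def by (rule Least_le) (use that P_def in auto)
  obtain x where "(x, x) \<in> r ^^ m" and odd: "odd m" using \<open>P m\<close> P_def by auto
  then obtain f where f: "f 0 = x" "f m = x" "\<And>i. i < m \<Longrightarrow> (f i, f (Suc i)) \<in> r"
    by (auto simp: relpow_fun_conv)
  have walk: "(f a, f (a + k)) \<in> r ^^ k" if "a + k \<le> m" for a k
    using that
  proof (induction k)
    case (Suc k)
    then have "(f a, f (a + k)) \<in> r ^^ k" "(f (a + k), f (Suc (a + k))) \<in> r"
      using f(3)[of "a + k"] by simp_all
    then show ?case by (metis add_Suc_right relpow_Suc_I)
  qed auto
  have wrap: "(f b, f a) \<in> r ^^ (m - (b - a))" if "a \<le> b" "b \<le> m" for a b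
  proof -
    have "(f b, f m) \<in> r ^^ (m - b)" using walk[of b "m - b"] that by simp
    moreover have "(f 0, f a) \<in> r ^^ a" using walk[of 0 a] that by simp
    ultimately have "(f b, f a) \<in> r ^^ (m - b + a)" unfolding relpow_add f(1,2) by (rule relcompI)
    then show ?thesis using that by (simp add: Nat.diff_diff_right)
  qed
  have inS: "f i \<in> S" if "i \<le> m" for i
  proof (cases "i = m")
    case True
    then show ?thesis using f(1,2) f(3)[of 0] odd unfolding r_def by (cases m) auto
  next
    case False
    then show ?thesis using f(3)[of i] that unfolding r_def by auto
  qed
  have dist: "f a \<noteq> f b" if "a < b" "b < m" for a b
  proof
    assume eq: "f a = f b"
    have "(f a, f a) \<in> r ^^ (b - a)" using walk[of a "b - a"] that eq by simp
    moreover have "(f a, f a) \<in> r ^^ (m - (b - a))" using wrap[of a b] that eq by simp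
    moreover have "odd (b - a) \<or> odd (m - (b - a))" using odd that by simp blast
    ultimately show False using least[of "b - a"] least[of "m - (b - a)"] that by force
  qed
  \<comment> \<open>The two walks closed by the chord have lengths with sum \<open>m + 2\<close>;
    one is odd, hence at least \<open>m\<close>, so the other has length at most 2 and the chord is
    an edge of the walk.\<close>
  have edge: "E (f a) (f b) \<longleftrightarrow> b = Suc a \<or> (a = 0 \<and> Suc b = m)" if "a < b" "b < m" for a b
  proof
    assume e: "E (f a) (f b)"
    then have r: "(f a, f b) \<in> r" "(f b, f a) \<in> r" using sym inS[of a] inS[of b] that unfolding
      r_def by auto
    have "(f a, f b) \<in> r ^^ (b - a)" using walk[of a "b - a"] that by simp
    then have 1: "(f a, f a) \<in> r ^^ Suc (b - a)" using r(2) by (rule relpow_Suc_I)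
    have 2: "(f b, f b) \<in> r ^^ Suc (m - (b - a))"
      using wrap[of a b] r(1) that by (intro relpow_Suc_I) auto
    have "odd (Suc (b - a)) \<or> odd (Suc (m - (b - a)))" using odd that by simp blast
    then have "m \<le> Suc (b - a) \<or> m \<le> Suc (m - (b - a))" using least[OF _ 1] least[OF _ 2] by blast
    then show "b = Suc a \<or> (a = 0 \<and> Suc b = m)" using that by linarith
  next
    assume "b = Suc a \<or> (a = 0 \<and> Suc b = m)"
    then show "E (f a) (f b)" using f(1-2) f(3)[of a] f(3)[of b] sym that unfolding r_def by auto
  qed
  have m1: "m \<noteq> 1" using \<open>(x, x) \<in> r ^^ m\<close> irrefl unfolding r_def by auto
  have m3: "m \<noteq> 3"
  proof
    assume "m = 3"
    then have "E (f 0) (f 1)" "E (f 1) (f 2)" "E (f 0) (f 2)" using edge by auto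
    then show False using tri[of "f 0" "f 1" "f 2"] inS \<open>m = 3\<close> by simp
  qed
  have m5: "m \<ge> 5"
  proof (rule ccontr)
    assume "\<not> 5 \<le> m"
    then have "m = 0 \<or> m = 1 \<or> m = 2 \<or> m = 3 \<or> m = 4" by auto
    then show False using odd m1 m3 by auto
  qed
  define n where "n = int m"
  define c where "c i = f (nat (i mod n))" for i
  have n5: "n \<ge> 5" using m5 n_def by simp
  have key: "(c i = c j \<longleftrightarrow> n dvd i - j) \<and> (E (c i) (c j) \<longleftrightarrow> n dvd i - j - 1 \<or> n dvd i - j + 1)"
    (is "?Q i j") if "i mod n \<le> j mod n" for i j
  proof -
    define a where "a = nat (i mod n)"
    define b where "b = nat (j mod n)"
    have ab: "a \<le> b" "b < m" using that n5 by (auto simp: a_def b_def n_def nat_less_iff)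
    have i: "i mod n = int a" and j: "j mod n = int b" using n5 by (auto simp: a_def b_def)
    have "n dvd i - j + s \<longleftrightarrow> n dvd int b - int a - s" for s
    proof -
      have "i = n * (i div n) + int a" "j = n * (j div n) + int b" using i j by (metis
        mult_div_mod_eq)+
      then have "i - j + s = - (int b - int a - s) + (i div n - j div n) * n"
        by (simp add: algebra_simps)
      then show ?thesis by (metis dvd_add_times_triv_right_iff dvd_minus_iff)
    qed
    from this[of 0] this[of 1] this[of "-1"]
    have d: "n dvd i - j \<longleftrightarrow> n dvd int b - int a" "n dvd i - j + 1 \<longleftrightarrow> n dvd int b - int a - 1"
      "n dvd i - j - 1 \<longleftrightarrow> n dvd int b - int a + 1" by simp_all
    have "c i = f a" "c j = f b" by (simp_all add: c_def a_def b_def)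
    show ?thesis
    proof (cases "a = b")
      case True
      then show ?thesis using \<open>c i = f a\<close> \<open>c j = f b\<close> d irrefl n5 zdvd_not_zless[of 1 n] by simp
    next
      case False
      then have lt: "a < b" using ab by simp
      have "\<not> n dvd int b - int a" using lt ab n_def zdvd_not_zless[of "int b - int a" n] by simp
      moreover have "n dvd int b - int a - 1 \<longleftrightarrow> b = Suc a"
        using lt ab n_def zdvd_not_zless[of "int b - int a - 1" n] by (cases "b = Suc a") auto
      moreover have "n dvd int b - int a + 1 \<longleftrightarrow> a = 0 \<and> Suc b = m"
      proof (cases "a = 0 \<and> Suc b = m")
        case False
        then have "int b - int a + 1 < n" using lt ab n_def by linarith
        then show ?thesis using lt False zdvd_not_zless[of "int b - int a + 1" n] by simp
      next
        case True
        then have "int b - int a + 1 = n" using n_def by simp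
        then show ?thesis using True by simp
      qed
      ultimately show ?thesis using d dist[OF lt ab(2)] edge[OF lt ab(2)] \<open>c i = f a\<close> \<open>c j = f b\<close>
        by auto
    qed
  qed
  have "?Q i j" for i j
  proof (cases "i mod n \<le> j mod n")
    case False
    then have "?Q j i" using key by simp
    moreover have "n dvd i - j + s \<longleftrightarrow> n dvd j - i - s" for s
      using dvd_minus_iff[of n "j - i - s"] by (simp add: algebra_simps)
    from this[of 0] this[of 1] this[of "-1"]
    have "n dvd i - j \<longleftrightarrow> n dvd j - i" "n dvd i - j + 1 \<longleftrightarrow> n dvd j - i - 1"
      "n dvd i - j - 1 \<longleftrightarrow> n dvd j - i + 1" by simp_all
    moreover have "E (c i) (c j) \<longleftrightarrow> E (c j) (c i)" using sym by blast
    ultimately show ?thesis by auto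
  qed (rule key)
  then have "hole E n c" unfolding hole_def by blast
  moreover have "range c \<subseteq> S"
  proof safe
    fix i
    have "i mod n < n" using n5 by simp
    then have "nat (i mod n) \<le> m" unfolding n_def nat_le_iff by simp
    then show "c i \<in> S" unfolding c_def by (rule inS)
  qed
  ultimately show ?thesis using that[of n c] odd n5 n_def by simp
qed

subsection \<open>Critical graphs and prisms\<close>

text \<open>The induced forbidden graphs appear as rules that conclude the one pair left open.
  Distinctness of their vertices is implied by the pattern of adjacencies; a spindle need not be
  induced, so \<open>u\<close> is required to be injective.\<close>

locale critical =
  fixes U :: "'a set" and E :: "'a \<Rightarrow> 'a \<Rightarrow> bool"
  assumes fin: "finite U" and E_in: "E x y \<Longrightarrow> x \<in> U" and sym: "E x y \<Longrightarrow> E y x"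
    and irrefl: "\<not> E x x"
    and noncol: "\<not> col_on E 3 U" and crit: "W \<subset> U \<Longrightarrow> col_on E 3 W"
    and bull: "E a b \<Longrightarrow> E b c \<Longrightarrow> E a c \<Longrightarrow> E x a \<Longrightarrow> \<not> E x b \<Longrightarrow> \<not> E x c \<Longrightarrow>
      E y b \<Longrightarrow> \<not> E y a \<Longrightarrow> \<not> E y c \<Longrightarrow> E x y"
    and C5: "E a b \<Longrightarrow> E b c \<Longrightarrow> E c d \<Longrightarrow> E d e \<Longrightarrow> E e a \<Longrightarrow> \<not> E a c \<Longrightarrow> \<not> E b d \<Longrightarrow>
      \<not> E c e \<Longrightarrow> \<not> E d a \<Longrightarrow> E e b"
    and spindle: "1 \<le> (p :: nat) \<Longrightarrow> inj_on u {..3 * p} \<Longrightarrow>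
      (\<And>k. k < p \<Longrightarrow> E (u (3 * k)) (u (3 * k + 1)) \<and> E (u (3 * k)) (u (3 * k + 2)) \<and>
        E (u (3 * k + 1)) (u (3 * k + 2)) \<and> E (u (3 * k + 1)) (u (3 * k + 3)) \<and>
        E (u (3 * k + 2)) (u (3 * k + 3))) \<Longrightarrow> \<not> E (u (3 * p)) (u 0)"
begin

lemma E_in': "E x y \<Longrightarrow> y \<in> U"
  using E_in sym by blast

text \<open>The spindle with one diamond.\<close>

lemma K4: "E a b \<Longrightarrow> E a c \<Longrightarrow> E b c \<Longrightarrow> E b d \<Longrightarrow> E c d \<Longrightarrow> \<not> E d a"
proof
  assume *: "E a b" "E a c" "E b c" "E b d" "E c d" "E d a"
  then have "distinct [a, b, c, d]" using irrefl sym by auto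
  then have "inj_on ((!) [a, b, c, d]) {..3 * 1}"
    by (intro inj_on_nth) auto
  from spindle[OF _ this] show False using * by simp
qed

text \<open>The spindle with two diamonds, from \<open>a\<close> to \<open>d\<close> and from
  \<open>d\<close> to \<open>g\<close>.\<close>

lemma Moser:
  assumes "E a b" "E a c" "E b c" "E b d" "E c d" "E d e" "E d f" "E e f" "E e g" "E f g"
    and "distinct [a, b, c, d, e, f, g]"
  shows "\<not> E g a"
proof
  assume g: "E g a"
  have inj: "inj_on ((!) [a, b, c, d, e, f, g]) {..3 * 2}"
    using assms(11) by (intro inj_on_nth) auto
  have "\<not> E ([a, b, c, d, e, f, g] ! (3 * 2)) ([a, b, c, d, e, f, g] ! 0)"
    by (rule spindle[OF _ inj]) (use assms in \<open>auto simp: less_2_cases_iff\<close>)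
  then show False using g by simp
qed

text \<open>If no edge left \<open>Y\<close>, the colourings of \<open>Y\<close> and of its
  complement that criticality provides would combine to one of \<open>U\<close>.\<close>

lemma connected:
  assumes "Y \<subseteq> U" "Y \<noteq> {}" "Y \<noteq> U"
  obtains y x where "y \<in> Y" "x \<in> U - Y" "E y x"
proof -
  obtain f :: "'a \<Rightarrow> nat" where f: "\<forall>x\<in>Y. f x < 3" "\<forall>x\<in>Y. \<forall>y\<in>Y. E x y \<longrightarrow> f x \<noteq> f y"
    using crit[of Y] assms unfolding col_on_def by blast
  have "U - Y \<subset> U" using assms by blast
  then obtain g :: "'a \<Rightarrow> nat" where g: "\<forall>x\<in>U-Y. g x < 3" "\<forall>x\<in>U-Y. \<forall>y\<in>U-Y. E x y \<longrightarrow> g x \<noteq> g y"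
    using crit[of "U - Y"] unfolding col_on_def by blast
  have "\<exists>y\<in>Y. \<exists>x\<in>U-Y. E y x"
  proof (rule ccontr)
    assume no: "\<not> ?thesis"
    have "col_on E 3 U" unfolding col_on_def
    proof (intro exI[of _ "\<lambda>x. if x \<in> Y then f x else g x"] conjI ballI impI)
      fix x assume "x \<in> U"
      then show "(if x \<in> Y then f x else g x) < 3" using f g by auto
    next
      fix x y assume "x \<in> U" "y \<in> U" "E x y"
      then show "(if x \<in> Y then f x else g x) \<noteq> (if y \<in> Y then f y else g y)"
        using f(2) g(2) no sym by (cases "x \<in> Y"; cases "y \<in> Y"; simp) blast+
    qed
    then show False using noncol by contradiction
  qed
  then show ?thesis using that by blast
qed

section \<open>Prisms and the vertices attached to them\<close>

definition prism :: "'a \<Rightarrow> 'a \<Rightarrow> 'a \<Rightarrow> 'a \<Rightarrow> 'a \<Rightarrow> 'a \<Rightarrow> bool" where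
  "prism a1 a2 a3 b1 b2 b3 \<longleftrightarrow> E a1 a2 \<and> E a1 a3 \<and> E a2 a3 \<and> E b1 b2 \<and> E b1 b3 \<and> E b2 b3 \<and>
     E a1 b1 \<and> E a2 b2 \<and> E a3 b3 \<and>
     \<not> E a1 b2 \<and> \<not> E a1 b3 \<and> \<not> E a2 b1 \<and> \<not> E a2 b3 \<and> \<not> E a3 b1 \<and> \<not> E a3 b2"

text \<open>A clone of \<open>a1\<close> behaves like \<open>a1\<close> towards the prism, except
  that adjacency to \<open>b1\<close> is left open; hence \<open>b1\<close> is not an
  argument.\<close>

definition clone :: "'a \<Rightarrow> 'a \<Rightarrow> 'a \<Rightarrow> 'a \<Rightarrow> 'a \<Rightarrow> 'a \<Rightarrow> bool" where
  "clone a1 a2 a3 b2 b3 x \<longleftrightarrow> E x a2 \<and> E x a3 \<and> \<not> E x a1 \<and> \<not> E x b2 \<and> \<not> E x b3"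

lemma prism_rot: "prism a1 a2 a3 b1 b2 b3 \<Longrightarrow> prism a2 a3 a1 b2 b3 b1"
  unfolding prism_def using sym by blast

lemma prism_flip: "prism a1 a2 a3 b1 b2 b3 \<Longrightarrow> prism a1 a3 a2 b1 b3 b2"
  unfolding prism_def using sym by blast

lemma prism_swap: "prism a1 a2 a3 b1 b2 b3 \<Longrightarrow> prism b1 b2 b3 a1 a2 a3"
  unfolding prism_def using sym by blast

text \<open>\<open>K4\<close> excludes \<open>a3\<close>, and bulls exclude seeing exactly one of
  \<open>b1\<close>, \<open>b2\<close>. If \<open>x\<close> saw both,
  \<open>a3, a1, a2, x, b1, b2, b3\<close> would be a Moser spindle, closed by the edge from
  \<open>b3\<close> to \<open>a3\<close>.\<close>

lemma prism_nbr_two: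
  assumes P: "prism a1 a2 a3 b1 b2 b3" and x: "E x a1" "E x a2"
  shows "clone a3 a1 a2 b1 b2 x"
proof -
  note P' = P[unfolded prism_def]
  have a3: "\<not> E x a3" using K4[of x a1 a2 a3] x P' sym by blast
  have 1: "\<not> E x b1" if "\<not> E x b2"
    using bull[of a1 b1 x a3 b2] that x P' a3 sym by blast
  have 2: "\<not> E x b2" if "\<not> E x b1"
    using bull[of a2 b2 x a3 b1] that x P' a3 sym by blast
  have "\<not> (E x b1 \<and> E x b2)"
  proof
    assume b: "E x b1 \<and> E x b2"
    have "\<not> E x b3" using K4[of x b1 b2 b3] b P' sym by blast
    then have "distinct [a3, a1, a2, x, b1, b2, b3]"
      using P' b x a3 irrefl sym by auto
    then show False using Moser[of a3 a1 a2 x b1 b2 b3] b x P' sym by blast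
  qed
  then show ?thesis unfolding clone_def using a3 1 2 x by blast
qed

text \<open>A vertex with \<open>a1\<close> as its only neighbour in that triangle is forced by two
  bulls to see \<open>b2\<close> and \<open>b3\<close>, and thus is a clone of
  \<open>b1\<close>.\<close>

lemma prism_nbr:
  assumes P: "prism a1 a2 a3 b1 b2 b3" and x: "E x a1"
  shows "clone b1 b2 b3 a2 a3 x \<or> clone a3 a1 a2 b1 b2 x \<or> clone a2 a1 a3 b1 b3 x"
proof (cases "E x a2 \<or> E x a3")
  case True
  then show ?thesis using prism_nbr_two[OF P x] prism_nbr_two[OF prism_flip[OF P] x] by blast
next
  case False
  note P' = P[unfolded prism_def]
  have "E x b2" using bull[of a1 a2 a3 x b2] x False P' sym by blast
  moreover have "E x b3" using bull[of a1 a3 a2 x b3] x False P' sym by blast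
  moreover have "\<not> E x b1" using K4[of x b1 b2 b3] calculation P' sym by blast
  ultimately show ?thesis using False by (simp add: clone_def)
qed

text \<open>The prism has a 3-colouring with classes \<open>{a1, b3}\<close>,
  \<open>{a2, b1}\<close>, \<open>{a3, b2}\<close>, and it extends to the clones. Adjacent clones of
  one vertex span a \<open>K4\<close>. For adjacent clones of \<open>a1\<close> and
  \<open>b3\<close>, a bull excludes the chord from \<open>x\<close> to \<open>b1\<close>, and the
  5-cycle \<open>x, a2, a1, b1, y\<close> is induced.\<close>

lemma prism_indep:
  assumes P: "prism a1 a2 a3 b1 b2 b3"
    and x: "clone a1 a2 a3 b2 b3 x \<or> clone b3 b1 b2 a1 a2 x"
    and y: "clone a1 a2 a3 b2 b3 y \<or> clone b3 b1 b2 a1 a2 y"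
  shows "\<not> E x y"
proof
  assume E: "E x y"
  note P' = P[unfolded prism_def]
  have cross: False if x: "clone a1 a2 a3 b2 b3 x" and y: "clone b3 b1 b2 a1 a2 y" and E: "E x y"
    for x y
  proof -
    note x = x[unfolded clone_def] and y = y[unfolded clone_def]
    have 1: "\<not> E x b1" using bull[of x b1 y a2 b3] x y E P' sym by blast
    have 2: "\<not> E y a3" using bull[of y a3 x b2 a1] x y E P' sym by blast
    show False using C5[of x a2 a1 b1 y] x y E P' 1 sym by blast
  qed
  have "\<not> (clone a1 a2 a3 b2 b3 x \<and> clone a1 a2 a3 b2 b3 y)"
    using K4[of x a2 a3 y] E P' sym unfolding clone_def by blast
  moreover have "\<not> (clone b3 b1 b2 a1 a2 x \<and> clone b3 b1 b2 a1 a2 y)"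
    using K4[of x b1 b2 y] E P' sym unfolding clone_def by blast
  ultimately show False using x y E cross[of x y] cross[of y x] sym by blast
qed

text \<open>Otherwise the triangle \<open>u, a2, a3\<close> with the pendant vertices
  \<open>z\<close> and \<open>b2\<close> is a bull. So no edge leaves the set of vertices that see
  the prism.\<close>

lemma clone_nbr:
  assumes P: "prism a1 a2 a3 b1 b2 b3" and u: "clone a1 a2 a3 b2 b3 u" and "E z u"
  shows "E z a2 \<or> E z a3 \<or> E z b2"
  using bull[of u a2 a3 z b2] assms sym unfolding prism_def clone_def by blast

lemma no_prism: "\<not> prism a1 a2 a3 b1 b2 b3"
proof
  assume P: "prism a1 a2 a3 b1 b2 b3"
  note rots = P prism_rot[OF P] prism_rot[OF prism_rot[OF P]]
  note Ps = rots rots[THEN prism_swap]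
  note P' = P[unfolded prism_def]
  define A1 where "A1 = clone a1 a2 a3 b2 b3"
  define A2 where "A2 = clone a2 a3 a1 b3 b1"
  define A3 where "A3 = clone a3 a1 a2 b1 b2"
  define B1 where "B1 = clone b1 b2 b3 a2 a3"
  define B2 where "B2 = clone b2 b3 b1 a3 a1"
  define B3 where "B3 = clone b3 b1 b2 a1 a2"
  note defs = A1_def A2_def A3_def B1_def B2_def B3_def
  have comm: "clone p q r s t = clone p r q t s" for p q r s t
    unfolding clone_def by blast
  define N where "N x \<longleftrightarrow> E x a1 \<or> E x a2 \<or> E x a3 \<or> E x b1 \<or> E x b2 \<or> E x b3" for x
  define C where "C x \<longleftrightarrow> A1 x \<or> A2 x \<or> A3 x \<or> B1 x \<or> B2 x \<or> B3 x" for x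
  have NC: "C x" if "N x" for x
    using that Ps[THEN prism_nbr, of x] comm unfolding N_def C_def defs by metis
  have CN: "N z" if "C u" "E z u" for u z
    using that Ps[THEN clone_nbr, of u z] unfolding N_def C_def defs by blast
  have all: "N x" if "x \<in> U" for x
  proof (rule ccontr)
    assume "\<not> N x"
    define Y where "Y = {y \<in> U. N y}"
    have "a2 \<in> Y" unfolding Y_def N_def using P' E_in sym by blast
    then obtain y z where yz: "y \<in> Y" "z \<in> U - Y" "E y z"
      using connected[of Y] \<open>\<not> N x\<close> \<open>x \<in> U\<close> unfolding Y_def by blast
    then show False using NC[of y] CN[of y z] sym unfolding Y_def by blast
  qed
  define f :: "'a \<Rightarrow> nat" where
    "f x = (if A1 x \<or> B3 x then 0 else if A2 x \<or> B1 x then 1 else 2)" for x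
  have "col_on E 3 U" unfolding col_on_def
  proof (intro exI[of _ f] conjI ballI impI)
    fix x assume "x \<in> U"
    then show "f x < 3" by (simp add: f_def)
  next
    fix x y assume xy: "x \<in> U" "y \<in> U" "E x y"
    have "\<not> ((A1 x \<or> B3 x) \<and> (A1 y \<or> B3 y))" "\<not> ((A2 x \<or> B1 x) \<and> (A2 y \<or> B1 y))"
      "\<not> ((A3 x \<or> B2 x) \<and> (A3 y \<or> B2 y))"
      using prism_indep[OF rots(1), of x y] prism_indep[OF rots(2), of x y]
        prism_indep[OF rots(3), of x y] xy(3) unfolding defs by blast+
    then show "f x \<noteq> f y" using NC[OF all[OF xy(1)]] NC[OF all[OF xy(2)]]
      unfolding f_def C_def by auto
  qed
  then show False using noncol by contradiction
qed

end

subsection \<open>Shortest odd holes\<close>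

locale critical_S = critical +
  assumes S123: "E x l \<Longrightarrow> E x p \<Longrightarrow> E p q \<Longrightarrow> E x r \<Longrightarrow> E r s \<Longrightarrow> E s t \<Longrightarrow>
      \<not> E l p \<Longrightarrow> \<not> E l q \<Longrightarrow> \<not> E l r \<Longrightarrow> \<not> E l s \<Longrightarrow> \<not> E l t \<Longrightarrow> \<not> E x q \<Longrightarrow> \<not> E x s \<Longrightarrow> \<not> E x t \<Longrightarrow>
      \<not> E p r \<Longrightarrow> \<not> E p s \<Longrightarrow> \<not> E p t \<Longrightarrow> \<not> E q r \<Longrightarrow> \<not> E q s \<Longrightarrow> \<not> E q t \<Longrightarrow> E r t"
    and wheel: "hole E n c \<Longrightarrow> odd n \<Longrightarrow> 3 \<le> n \<Longrightarrow> \<exists>i. \<not> E v (c i)"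

text \<open>Minimality concerns the size of triangle-free non-bipartite sets instead of the length
  of holes: a competing set then only has to be shown not 2-colourable, without exhibiting an
  induced cycle in it.\<close>

locale shortest_odd_hole = critical_S +
  fixes n :: int
  assumes n: "odd n" "7 \<le> n"
    and shortest: "S \<subseteq> U \<Longrightarrow> \<not> col_on E 2 S \<Longrightarrow>
      (\<And>x y z. x \<in> S \<Longrightarrow> y \<in> S \<Longrightarrow> z \<in> S \<Longrightarrow> E x y \<Longrightarrow> E y z \<Longrightarrow> \<not> E x z) \<Longrightarrow> n \<le> int (card S)"
begin

lemma not_dvd: "k \<noteq> 0 \<Longrightarrow> \<bar>k\<bar> < n \<Longrightarrow> \<not> n dvd k"
  using dvd_imp_le_int[of k n] by auto

lemma small_not_dvd [simp]:
  "\<bar>n\<bar> \<noteq> 1" "\<not> n dvd 1" "\<not> n dvd 2" "\<not> n dvd 3" "\<not> n dvd 4" "\<not> n dvd 5" "\<not> n dvd 6"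
  "\<not> n dvd -1" "\<not> n dvd -2" "\<not> n dvd -3" "\<not> n dvd -4" "\<not> n dvd -5" "\<not> n dvd -6"
  using n not_dvd by auto

lemma hole_eq: "hole E n c \<Longrightarrow> c i = c j \<longleftrightarrow> n dvd i - j"
  by (simp add: hole_def)

lemma hole_adj: "hole E n c \<Longrightarrow> E (c i) (c j) \<longleftrightarrow> n dvd i - j - 1 \<or> n dvd i - j + 1"
  by (simp add: hole_def)

text \<open>For indices at distance at most 5, the numbers \<open>i - j - 1\<close> and
  \<open>i - j + 1\<close> have absolute value at most 6, which is below \<open>n\<close>, so that
  divisibility by \<open>n\<close> means being 0.\<close>

lemma hole_near: "hole E n c \<Longrightarrow> \<bar>i - j\<bar> \<le> 5 \<Longrightarrow> E (c i) (c j) \<longleftrightarrow> \<bar>i - j\<bar> = 1"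
  using hole_adj[of c i j] not_dvd[of "i - j - 1"] not_dvd[of "i - j + 1"] n
  by (cases "i - j = 1"; cases "i - j = -1") auto

lemma hole_in: "hole E n c \<Longrightarrow> c i \<in> U"
  using hole_near[of c i "i + 1"] E_in by simp

lemma hole_shift: "hole E n c \<Longrightarrow> hole E n (\<lambda>i. c (i + k))"
  by (simp add: hole_def)

text \<open>The vertices that can replace \<open>c i\<close> on the hole, as false or true twins.\<close>

definition cls :: "(int \<Rightarrow> 'a) \<Rightarrow> int \<Rightarrow> 'a \<Rightarrow> bool" where
  "cls c i v \<longleftrightarrow> E v (c (i - 1)) \<and> E v (c (i + 1)) \<and>
    (\<forall>j. E v (c j) \<longrightarrow> n dvd j - i \<or> n dvd j - i - 1 \<or> n dvd j - i + 1)"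

lemma cls_shift: "cls (\<lambda>i. c (i + k)) i v \<longleftrightarrow> cls c (i + k) v"
proof -
  have "(\<forall>j. E v (c (j + k)) \<longrightarrow> n dvd j - i \<or> n dvd j - i - 1 \<or> n dvd j - i + 1) \<longleftrightarrow>
    (\<forall>j. E v (c j) \<longrightarrow> n dvd j - (i + k) \<or> n dvd j - (i + k) - 1 \<or> n dvd j - (i + k) + 1)"
    (is "?L \<longleftrightarrow> ?R")
  proof
    assume ?L
    show ?R
    proof (intro allI impI)
      fix j assume "E v (c j)"
      then show "n dvd j - (i + k) \<or> n dvd j - (i + k) - 1 \<or> n dvd j - (i + k) + 1"
        using \<open>?L\<close>[rule_format, of "j - k"] by (simp add: algebra_simps)
    qed
  next
    assume ?R
    show ?L
    proof (intro allI impI)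
      fix j assume "E v (c (j + k))"
      then show "n dvd j - i \<or> n dvd j - i - 1 \<or> n dvd j - i + 1"
        using \<open>?R\<close>[rule_format, of "j + k"] by (simp add: algebra_simps)
    qed
  qed
  then show ?thesis by (simp add: cls_def algebra_simps)
qed

lemma cls_self: "hole E n c \<Longrightarrow> cls c i (c i)"
proof -
  assume h: "hole E n c"
  have "n dvd j - i - 1 \<or> n dvd j - i + 1" if "E (c i) (c j)" for j
    using that sym hole_adj[OF h, of j i] by blast
  then show ?thesis using hole_near[OF h, of i] by (auto simp: cls_def)
qed

text \<open>As the hole has no hub, the run of neighbours through \<open>c j\<close> has a first
  index \<open>a\<close>. Bulls at this start force the neighbours to be exactly those at
  \<open>a\<close>, \<open>a + 1\<close>, \<open>a + 2\<close>, so \<open>v\<close> is a true twin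
  of \<open>c (a + 1)\<close>.\<close>

lemma run_cls:
  assumes h: "hole E n c" and "E v (c j)" "E v (c (j + 1))"
  shows "\<exists>i. cls c i v"
proof -
  obtain k where k: "\<not> E v (c k)" using wheel[OF h] n by auto
  have ex: "\<exists>m. \<not> E v (c (j - int m))"
  proof
    have "c (j - int (nat ((j - k) mod n))) = c k"
      unfolding hole_eq[OF h] using n by (simp add: minus_mod_eq_mult_div[symmetric]
        mod_eq_dvd_iff[symmetric] mod_simps)
    then show "\<not> E v (c (j - int (nat ((j - k) mod n))))" using k by simp
  qed
  define m where "m = (LEAST m. \<not> E v (c (j - int m)))"
  have m: "\<not> E v (c (j - int m))" unfolding m_def by (rule LeastI_ex[OF ex])
  have less: "E v (c (j - int l))" if "l < m" for l
    using not_less_Least[of l "\<lambda>m. \<not> E v (c (j - int m))"] that unfolding m_def by blast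
  have m0: "m \<noteq> 0" using m assms(2) by (cases m) auto
  define a where "a = j - int m + 1"
  have 0: "\<not> E v (c (a - 1))" using m by (simp add: a_def)
  have 1: "E v (c a)" using less[of "m - 1"] m0 by (simp add: a_def of_nat_diff algebra_simps)
  have 2: "E v (c (a + 1))"
  proof (cases "m = 1")
    case True
    then show ?thesis using assms(3) by (simp add: a_def)
  next
    case False
    then have "j - int (m - 2) = a + 1" using m0 by (simp add: a_def of_nat_diff)
    moreover have "E v (c (j - int (m - 2)))" using less[of "m - 2"] m0 by simp
    ultimately show ?thesis by simp
  qed
  note near = hole_near[OF h]
  \<comment> \<open>Otherwise \<open>c (a - 1)\<close> and \<open>c k\<close> are the pendant
    vertices of a bull on the triangle \<open>c a\<close>, \<open>v\<close>,
    \<open>c (a + 1)\<close>.\<close>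
  have far: "n dvd k - a \<or> n dvd k - a - 1 \<or> n dvd k - a + 1 \<or> n dvd k - a - 2 \<or> n dvd k - a + 2"
    if "E v (c k)" for k
  proof -
    have "E (c k) (c a) \<or> E (c k) (c (a + 1)) \<or> E (c k) (c (a - 1))"
      using bull[of "c a" v "c (a + 1)" "c (a - 1)" "c k"] that 0 1 2
        near[of a "a + 1"] near[of "a - 1" a] near[of "a - 1" "a + 1"] sym by auto
    then show ?thesis unfolding hole_adj[OF h] by (auto simp: algebra_simps)
  qed
  have 3: "E v (c (a + 2))"
    using bull[of "c a" "c (a + 1)" v "c (a - 1)" "c (a + 2)"] 0 1 2 near[of a "a + 1"] near[of
      "a - 1" a]
      near[of "a - 1" "a + 1"] near[of "a + 2" a] near[of "a + 2" "a + 1"] near[of "a - 1" "a + 2"]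
        sym by auto
  have 4: "\<not> E v (c (a + 3))" using far[of "a + 3"] by auto
  have 5: "\<not> E v (c (a - 2))"
    using bull[of "c (a + 2)" v "c (a + 1)" "c (a + 3)" "c (a - 2)"] 2 3 4
      near[of "a + 2" "a + 1"] near[of "a + 3" "a + 2"] near[of "a + 3" "a + 1"] near[of "a - 2"
        "a + 2"]
      near[of "a - 2" "a + 1"] near[of "a + 3" "a - 2"] sym by auto
  have "n dvd k - (a + 1) \<or> n dvd k - (a + 1) - 1 \<or> n dvd k - (a + 1) + 1" if "E v (c k)" for k
  proof -
    have "\<not> n dvd k - a + 1" using that 0 hole_eq[OF h, of k "a - 1"] by (auto simp: algebra_simps)
    moreover have "\<not> n dvd k - a + 2" using that 5 hole_eq[OF h, of k "a - 2"] by (auto simp: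
      algebra_simps)
    ultimately show ?thesis using far[OF that] by (auto simp: algebra_simps)
  qed
  then have "cls c (a + 1) v" using 1 3 by (simp add: cls_def add.commute)
  then show ?thesis by blast
qed

text \<open>Three index steps of 1 or -1 would add up to a multiple of \<open>n\<close>, but such a
  sum is odd and of absolute value at most 3.\<close>

lemma hole_no_triangle: "hole E n c \<Longrightarrow> E (c i) (c j) \<Longrightarrow> E (c j) (c k) \<Longrightarrow> \<not> E (c i) (c k)"
proof
  assume h: "hole E n c" and "E (c i) (c j)" "E (c j) (c k)" "E (c i) (c k)"
  then obtain s t u where s: "n dvd i - j + s" "n dvd j - k + t" "n dvd i - k + u"
    and stu: "s \<in> {-1, 1}" "t \<in> {-1, 1}" "u \<in> {-1, 1}"
    unfolding hole_adj[OF h] by (metis add_uminus_conv_diff insertCI)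
  have "n dvd (i - j + s) + (j - k + t) - (i - k + u)" by (rule dvd_diff[OF dvd_add[OF s(1,2)]
    s(3)])
  then have "n dvd s + t - u" by (simp add: algebra_simps)
  then show False using stu by auto
qed

text \<open>Since \<open>n\<close> is odd, some gap between successive neighbours of
  \<open>v\<close> is odd. Together with \<open>v\<close> it forms an odd cycle, and minimality
  leaves only the gap \<open>n - 2\<close>, which makes \<open>v\<close> a false twin, or the gap
  \<open>n\<close> of a vertex with a single neighbour.\<close>

lemma spread_cls:
  assumes h: "hole E n c" and v0: "E v (c 0)" and nc: "\<And>j. \<not> (E v (c j) \<and> E v (c (j + 1)))"
  shows "\<exists>i. cls c i v"
proof -
  note near = hole_near[OF h]
  define P where "P m \<longleftrightarrow> odd m \<and> E v (c (int m))" for m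
  have "c n = c 0" using hole_eq[OF h, of n 0] by simp
  then have Pn: "P (nat n)" using n v0 by (simp add: P_def even_nat_iff)
  define m where "m = (LEAST m. P m)"
  have Pm: "P m" unfolding m_def by (rule LeastI[of P, OF Pn])
  have mn: "m \<le> nat n" unfolding m_def by (rule Least_le[of P, OF Pn])
  have least: "\<not> P l" if "l < m" for l using that not_less_Least[of l P] unfolding m_def by blast
  \<comment> \<open>The index \<open>i\<close> of the last neighbour before \<open>m\<close> is even
    by the choice of \<open>m\<close>, so the gap is odd; \<open>nc\<close> excludes the gap
    1.\<close>
  define i where "i = Max {l. l < m \<and> E v (c (int l))}"
  have fin: "finite {l. l < m \<and> E v (c (int l))}" by simp
  have m0: "0 < m" using Pm by (cases m) (auto simp: P_def)
  then have "i \<in> {l. l < m \<and> E v (c (int l))}" unfolding i_def using v0 by (intro Max_in[OF fin])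
    auto
  then have i: "i < m" "E v (c (int i))" by auto
  have between: "\<not> E v (c (int l))" if "i < l" "l < m" for l
  proof
    assume "E v (c (int l))"
    then have "l \<le> i" unfolding i_def using that by (intro Max_ge[OF fin]) auto
    then show False using that by simp
  qed
  have between': "\<not> E v (c l)" if "int i < l" "l < int m" for l
    using between[of "nat l"] that by auto
  have odd: "odd m" "even i" using Pm i least[of i] by (auto simp: P_def)
  have vm: "E v (c (int m))" using Pm by (simp add: P_def)
  have "m \<noteq> Suc i" using nc[of "int i"] i vm by (auto simp: add.commute)
  then have g3: "3 \<le> int m - int i" using odd i(1) by presburger
  show ?thesis
  proof (cases "int m - int i = n")
    case True
    then have mi: "int i = 0" "int m = n" using mn n by auto
    have cn: "c (- k) = c (n - k)" for k using hole_eq[OF h, of "- k" "n - k"] by simp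
    have no: "\<not> E v (c 1)" "\<not> E v (c 2)" "\<not> E v (c (-1))" "\<not> E v (c (-2))" "\<not> E v (c (-3))"
      unfolding cn using between' mi n by auto
    \<comment> \<open>Here \<open>v\<close> sees \<open>c 0\<close> only: S_{1,2,3} with centre
      \<open>c 0\<close>, leaf \<open>v\<close>, and the other two legs along the hole in opposite
      directions.\<close>
    have False
      using S123[of "c 0" v "c 1" "c 2" "c (-1)" "c (-2)" "c (-3)"] v0 no sym
        near[of 0 1] near[of 1 2] near[of 0 "-1"] near[of "-1" "-2"] near[of "-2" "-3"] near[of 0 2]
        near[of 0 "-2"] near[of 0 "-3"] near[of 1 "-1"] near[of 1 "-2"] near[of 1 "-3"]
        near[of 2 "-1"] near[of 2 "-2"] near[of 2 "-3"] near[of "-1" "-3"] by auto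
    then show ?thesis ..
  next
    case False
    then have "int m - int i < n" using mn n by linarith
    then have gn: "int m - int i \<le> n - 2" using odd n(1) by presburger
    let ?S = "insert v (c ` {int i..int m})"
    have vS: "l = int i \<or> l = int m" if "E v (c l)" "l \<in> {int i..int m}" for l
      using that between'[of l] by force
    have imE: "\<not> E (c (int m)) (c (int i))" "\<not> E (c (int i)) (c (int m))"
      using hole_adj[OF h, of "int m" "int i"] gn g3 not_dvd[of "int m - int i - 1"]
        not_dvd[of "int m - int i + 1"] sym by auto
    have one: "\<not> (E v p \<and> E v q \<and> E p q)" if pq: "p \<in> ?S" "q \<in> ?S" for p q
    proof
      assume E: "E v p \<and> E v q \<and> E p q"
      then obtain a b where "p = c a" "a \<in> {int i..int m}" "q = c b" "b \<in> {int i..int m}"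
        using pq irrefl by blast
      then have "p = c (int i) \<or> p = c (int m)" "q = c (int i) \<or> q = c (int m)" using vS E by blast+
      then show False using E imE irrefl by metis
    qed
    \<comment> \<open>The set is an odd cycle on \<open>m - i + 2\<close> vertices, and the gap is
      at most \<open>n - 2\<close>; hence equality.\<close>
    have "n \<le> int (card ?S)"
    proof (rule shortest)
      show "?S \<subseteq> U" using E_in[OF v0] hole_in[OF h] by blast
      show "\<not> E x z" if xyz: "x \<in> ?S" "y \<in> ?S" "z \<in> ?S" "E x y" "E y z" for x y z
      proof
        assume "E x z"
        have E': "E y x" "E z y" "E z x" using xyz \<open>E x z\<close> by (blast intro: sym)+
        show False
        proof (cases "x = v \<or> y = v \<or> z = v")
          case True
          then show False using one[of y z] one[of x z] one[of x y] xyz E' \<open>E x z\<close> by auto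
        next
          case False
          then obtain a b d where "x = c a" "y = c b" "z = c d" using xyz by auto
          then show False using hole_no_triangle[OF h] xyz \<open>E x z\<close> by blast
        qed
      qed
      show "\<not> col_on E 2 ?S"
      proof
        assume "col_on E 2 ?S"
        then obtain f :: "'a \<Rightarrow> nat" where f: "\<forall>x\<in>?S. f x < 2" "\<forall>x\<in>?S. \<forall>y\<in>?S. E x y \<longrightarrow> f x \<noteq> f y"
          unfolding col_on_def by blast
        have alt: "f (c (int i + int l)) = f (c (int i)) \<longleftrightarrow> even l" if "i + l \<le> m" for l
          using that
        proof (induction l)
          case (Suc l)
          let ?x = "c (int i + int l)" and ?y = "c (int i + int (Suc l))"
          have m: "?x \<in> ?S" "?y \<in> ?S" "c (int i) \<in> ?S" using Suc.prems by auto
          have "E ?x ?y" using near[of "int i + int l" "int i + int (Suc l)"] by simp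
          then have "f ?x \<noteq> f ?y" using f(2) m by blast
          moreover have "f ?x < 2" "f ?y < 2" "f (c (int i)) < 2" using f(1) m by blast+
          ultimately show ?case using Suc by auto
        qed simp
        have "f (c (int m)) \<noteq> f (c (int i))" using alt[of "m - i"] i(1) odd by simp
        moreover have mem: "c (int m) \<in> ?S" "c (int i) \<in> ?S" "v \<in> ?S" using i(1) by auto
        then have "f v \<noteq> f (c (int m))" "f v \<noteq> f (c (int i))" using f(2) vm i(2) by blast+
        moreover have "f v < 2" "f (c (int m)) < 2" "f (c (int i)) < 2" using f(1) mem by blast+
        ultimately show False by linarith
      qed
    qed
    also have "card ?S \<le> Suc (card (c ` {int i..int m}))" by (rule card_insert_le_m1) auto
    also have "card (c ` {int i..int m}) \<le> nat (int m - int i + 1)"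
      using card_image_le[of "{int i..int m}" c] by simp
    finally have "int m = int i + n - 2" using gn g3 by linarith
    then have m: "c (int m + 1 + 1) = c (int i)" using hole_eq[OF h] by simp
    have "cls c (int m + 1) v" unfolding cls_def
    proof (intro conjI allI impI)
      show "E v (c (int m + 1 - 1))" using vm by simp
      show "E v (c (int m + 1 + 1))" using m i(2) by simp
      fix k assume k: "E v (c k)"
      define l where "l = int i + (k - int i) mod n"
      have kl: "n dvd k - l" unfolding l_def
        by (metis diff_diff_eq dvd_minus_mod)
      then have "E v (c l)" using k hole_eq[OF h, of k l] by simp
      moreover have "int i \<le> l" "l < int i + n" using n by (simp_all add: l_def)
      ultimately have "l = int i \<or> l = int m \<or> l = int m + 1"
        using between'[of l] \<open>int m = int i + n - 2\<close> by force
      then have "n dvd l - (int m + 1) + 0 \<or> n dvd l - (int m + 1) + -1 \<or> n dvd l - (int m + 1) + 1"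
        using \<open>int m = int i + n - 2\<close> by auto
      moreover have "n dvd k - (int m + 1) + s" if "n dvd l - (int m + 1) + s" for s
        using dvd_add[OF kl that] by (simp add: algebra_simps)
      ultimately show
        "n dvd k - (int m + 1) \<or> n dvd k - (int m + 1) - 1 \<or> n dvd k - (int m + 1) + 1"
        by (metis add_0_right add_uminus_conv_diff)
    qed
    then show ?thesis by blast
  qed
qed

lemma cls_exists:
  assumes h: "hole E n c" and "E v (c j)"
  shows "\<exists>i. cls c i v"
proof (cases "\<exists>k. E v (c k) \<and> E v (c (k + 1))")
  case True
  then show ?thesis using run_cls[OF h] by blast
next
  case False
  have "\<exists>i. cls (\<lambda>i. c (i + j)) i v"
  proof (rule spread_cls[OF hole_shift[OF h]])
    show "\<not> (E v (c (k + j)) \<and> E v (c (k + 1 + j)))" for k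
      using False by (metis add.assoc add.commute)
  qed (use assms in simp)
  then show ?thesis unfolding cls_shift by blast
qed

lemma cls_near:
  "hole E n c \<Longrightarrow> cls c i v \<Longrightarrow> E v (c j) \<Longrightarrow> n dvd j - i \<or> n dvd j - i - 1 \<or> n dvd j - i + 1"
  by (simp add: cls_def)

text \<open>Two numbers that differ by 2 are both within 1 of 0 modulo \<open>n\<close> only if 0 is
  their midpoint. This reads off the class of a vertex from its neighbours in positions
  \<open>i - 1\<close> and \<open>i + 1\<close>.\<close>

lemma near_two:
  assumes "n dvd a \<or> n dvd a - 1 \<or> n dvd a + 1" "n dvd a + 2 \<or> n dvd a + 2 - 1 \<or> n dvd a + 2 + 1"
  shows "n dvd a + 1"
proof (rule ccontr)
  assume no: "\<not> n dvd a + 1"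
  then have "n dvd a \<or> n dvd a - 1" "n dvd a + 2 \<or> n dvd a + 3" using assms by (auto simp:
    add.commute)
  then show False
    using dvd_diff[of n "a + 2" a] dvd_diff[of n "a + 3" a] dvd_diff[of n "a + 2" "a - 1"]
      dvd_diff[of n "a + 3" "a - 1"] by auto
qed

lemma cls_unique:
  assumes h: "hole E n c" and "cls c i v" "cls c j v"
  shows "n dvd i - j"
  using near_two[of "i - 1 - j"] cls_near[OF h assms(3), of "i - 1"] cls_near[OF h assms(3), of
    "i + 1"]
    assms(2) by (simp add: cls_def algebra_simps)

lemma cls_cong:
  assumes h: "hole E n c" and "cls c i v" "n dvd i - j"
  shows "cls c j v"
proof -
  have "c (i - 1) = c (j - 1)" "c (i + 1) = c (j + 1)" using hole_eq[OF h] assms(3) by simp_all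
  moreover have "n dvd k - j + s" if "n dvd k - i + s" for k s
    using dvd_add[OF that assms(3)] by (simp add: algebra_simps)
  from this[of _ 0] this[of _ 1] this[of _ "-1"]
  have "n dvd k - j \<or> n dvd k - j - 1 \<or> n dvd k - j + 1" if "E v (c k)" for k
    using cls_near[OF h assms(2) that] by auto
  ultimately show ?thesis using assms(2) by (simp add: cls_def)
qed

section \<open>Replacing a hole vertex by a twin, and adjacency between the classes\<close>

definition subst :: "(int \<Rightarrow> 'a) \<Rightarrow> int \<Rightarrow> 'a \<Rightarrow> int \<Rightarrow> 'a" where
  "subst c i v j = (if n dvd j - i then v else c j)"

lemma dvd_flip: "n dvd a - b \<longleftrightarrow> n dvd b - a" "n dvd a - b - 1 \<longleftrightarrow> n dvd b - a + 1"
  "n dvd a - b + 1 \<longleftrightarrow> n dvd b - a - 1" for a b :: int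
  using dvd_minus_iff[of n "a - b"] dvd_minus_iff[of n "a - b - 1"] dvd_minus_iff[of n "a - b + 1"]
  by (simp_all add: algebra_simps)

text \<open>All results about \<open>c\<close> thereby hold for the hole through \<open>v\<close> as
  well, which is how two classes are compared below.\<close>

lemma hole_subst:
  assumes h: "hole E n c" and v: "cls c i v"
  shows "hole E n (subst c i v)"
proof -
  have adj: "E v (c j) \<longleftrightarrow> n dvd i - j - 1 \<or> n dvd i - j + 1" if "\<not> n dvd j - i" for j
  proof
    assume "E v (c j)"
    then show "n dvd i - j - 1 \<or> n dvd i - j + 1"
      using cls_near[OF h v] that unfolding dvd_flip(2,3)[of i j] by blast
  next
    assume "n dvd i - j - 1 \<or> n dvd i - j + 1"
    then have "c j = c (i - 1) \<or> c j = c (i + 1)"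
      unfolding hole_eq[OF h] dvd_flip(2,3)[of i j] by (auto simp: algebra_simps)
    then show "E v (c j)" using v unfolding cls_def by metis
  qed
  have ne: "v \<noteq> c j" if "\<not> n dvd j - i" for j
    using cls_unique[OF h v, of j] cls_self[OF h, of j] that dvd_flip(1) by blast
  have cong: "n dvd a - b + s \<longleftrightarrow> n dvd a' - b + s" if "n dvd a - a'" for a a' b s
    using dvd_add_right_iff[OF that, of "a' - b + s"] by (simp add: algebra_simps)
  have cong3: "(n dvd a - b \<longleftrightarrow> n dvd a' - b) \<and> (n dvd a - b + 1 \<longleftrightarrow> n dvd a' - b + 1) \<and>
      (n dvd a - b - 1 \<longleftrightarrow> n dvd a' - b - 1)" if "n dvd a - a'" for a a' b
    using cong[OF that, of b 0] cong[OF that, of b 1] cong[OF that, of b "-1"] by simp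
  show ?thesis unfolding hole_def
  proof (intro conjI allI)
    fix j k
    show "subst c i v j = subst c i v k \<longleftrightarrow> n dvd j - k"
    proof (cases "n dvd j - i")
      case True
      then show ?thesis using cong3[OF True, of k] ne[of k] dvd_flip(1)[of i k] by (auto simp:
        subst_def)
    next
      case j: False
      show ?thesis
      proof (cases "n dvd k - i")
        case True
        then show ?thesis using cong3[OF True, of j] ne[of j] j dvd_flip(1)[of i j] dvd_flip(1)[of
          k j]
          by (auto simp: subst_def)
      next
        case False
        then show ?thesis using j hole_eq[OF h] by (simp add: subst_def)
      qed
    qed
    show "E (subst c i v j) (subst c i v k) \<longleftrightarrow> n dvd j - k - 1 \<or> n dvd j - k + 1"
    proof (cases "n dvd j - i")
      case j: True
      show ?thesis
      proof (cases "n dvd k - i")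
        case True
        then have "n dvd j - k" using j dvd_diff[OF j True] by simp
        then have "n dvd j - k - 1 \<longleftrightarrow> n dvd 1" "n dvd j - k + 1 \<longleftrightarrow> n dvd 1"
          using dvd_diff_right_iff dvd_add_right_iff by blast+
        then show ?thesis using j True irrefl by (simp add: subst_def)
      next
        case False
        then show ?thesis using j adj[OF False] cong3[OF j, of k] by (simp add: subst_def)
      qed
    next
      case j: False
      show ?thesis
      proof (cases "n dvd k - i")
        case True
        then have "E (subst c i v j) (subst c i v k) \<longleftrightarrow> E v (c j)" using j sym by (auto simp:
          subst_def)
        then show ?thesis using adj[OF j] cong3[OF True, of j] dvd_flip(2,3)[of j k] by auto
      next
        case False
        then show ?thesis using j hole_adj[OF h] by (simp add: subst_def)
      qed
    qed
  qed
qed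

text \<open>On the hole through \<open>v\<close>, the vertex \<open>w\<close> still sees positions
  \<open>j - 1\<close> and \<open>j + 1\<close>, so its class is again \<open>j\<close>; as it also
  sees \<open>v\<close> in position \<open>i\<close>, the two positions are close.\<close>

lemma cls_adj:
  assumes h: "hole E n c" and v: "cls c i v" and w: "cls c j w" and vw: "E v w"
  shows "n dvd i - j \<or> n dvd i - j - 1 \<or> n dvd i - j + 1"
proof (rule ccontr)
  assume no: "\<not> ?thesis"
  note h' = hole_subst[OF h v]
  have "subst c i v i = v" by (simp add: subst_def)
  then have wi: "E w (subst c i v i)" using sym[OF vw] by simp
  then obtain k where k: "cls (subst c i v) k w" using cls_exists[OF h'] by blast
  have "subst c i v (j - 1) = c (j - 1)" "subst c i v (j + 1) = c (j + 1)"
    using no dvd_flip[of i j] by (auto simp: subst_def algebra_simps)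
  then have "E w (subst c i v (j - 1))" "E w (subst c i v (j + 1))" using w by (auto simp: cls_def)
  then have "n dvd j - k"
    using near_two[of "j - 1 - k"] cls_near[OF h' k, of "j - 1"] cls_near[OF h' k, of "j + 1"]
    by (simp add: algebra_simps)
  then have "n dvd i - j + s" if "n dvd i - k + s" for s
    using dvd_diff[OF that, of "j - k"] by (simp add: algebra_simps)
  from this[of 0] this[of 1] this[of "-1"] show False
    using cls_near[OF h' k wi] no by auto
qed

text \<open>On the hole through \<open>v\<close>, the vertex \<open>w\<close> sees position
  \<open>i + 2\<close> but neither \<open>i + 3\<close> nor \<open>i + 4\<close>. Only the class
  \<open>i + 1\<close> remains, whose members see position \<open>i\<close>, now held by
  \<open>v\<close>.\<close>

lemma cls_complete:
  assumes h: "hole E n c" and v: "cls c i v" and w: "cls c (i + 1) w"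
  shows "E v w"
proof -
  note h' = hole_subst[OF h v]
  have sub: "subst c i v (i + 2) = c (i + 2)" "subst c i v (i + 3) = c (i + 3)"
    "subst c i v (i + 4) = c (i + 4)"
    "subst c i v i = v" by (simp_all add: subst_def)
  have w2: "E w (subst c i v (i + 2))" using w sub(1) by (simp add: cls_def add.assoc)
  then obtain k where k: "cls (subst c i v) k w" using cls_exists[OF h'] by blast
  have no: "\<not> E w (c (i + 3))" "\<not> E w (c (i + 4))"
    using cls_near[OF h w, of "i + 3"] cls_near[OF h w, of "i + 4"] by auto
  have "n dvd i + 2 - k \<or> n dvd i + 2 - k - 1 \<or> n dvd i + 2 - k + 1" by (rule cls_near[OF h' k w2])
  moreover have "\<not> n dvd i + 2 - k"
  proof
    assume "n dvd i + 2 - k"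
    then have "subst c i v (k + 1) = subst c i v (i + 3)" unfolding hole_eq[OF h']
      using dvd_flip(1)[of k "i + 2"] by (simp add: algebra_simps)
    then show False using k no sub by (simp add: cls_def)
  qed
  moreover have "\<not> n dvd i + 2 - k + 1"
  proof
    assume "n dvd i + 2 - k + 1"
    then have "subst c i v (k + 1) = subst c i v (i + 4)" unfolding hole_eq[OF h']
      using dvd_flip(1)[of k "i + 3"] by (simp add: algebra_simps)
    then show False using k no sub by (simp add: cls_def)
  qed
  ultimately have "n dvd i + 1 - k" by (simp add: algebra_simps)
  then have "subst c i v (k - 1) = subst c i v i" unfolding hole_eq[OF h']
    using dvd_flip(1)[of k "i + 1"] by (simp add: algebra_simps)
  then show ?thesis using k sub sym by (simp add: cls_def)
qed

text \<open>By connectivity it suffices that a neighbour \<open>x\<close> of a class member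
  \<open>y\<close> sees the hole. On the hole through \<open>y\<close>, it sees the positions on
  both sides of its class, and only one of them can be that of \<open>y\<close>.\<close>

lemma cls_all:
  assumes h: "hole E n c" and "v \<in> U"
  shows "\<exists>i. cls c i v"
proof (rule ccontr)
  assume no: "\<not> ?thesis"
  define Y where "Y = {y \<in> U. \<exists>i. cls c i y}"
  have "c 0 \<in> Y" using cls_self[OF h] hole_in[OF h] unfolding Y_def by blast
  then obtain y x where y: "y \<in> Y" and x: "x \<in> U - Y" and E: "E y x"
    using connected[of Y] no assms(2) unfolding Y_def by blast
  obtain i where i: "cls c i y" using y Y_def by blast
  note h' = hole_subst[OF h i]
  have "subst c i y i = y" by (simp add: subst_def)
  then obtain k where k: "cls (subst c i y) k x" using cls_exists[OF h', of x i] sym[OF E] by auto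
  have "\<not> (n dvd k - 1 - i \<and> n dvd k + 1 - i)"
    using dvd_diff[of n "k + 1 - i" "k - 1 - i"] by auto
  then have "E x (c (k - 1)) \<or> E x (c (k + 1))" using k unfolding cls_def subst_def by metis
  then show False using cls_exists[OF h] x Y_def by blast
qed

section \<open>Classes with an edge: spindle or 3-colouring\<close>

definition heavy :: "(int \<Rightarrow> 'a) \<Rightarrow> int \<Rightarrow> bool" where
  "heavy c i \<longleftrightarrow> (\<exists>x y. cls c i x \<and> cls c i y \<and> E x y)"

lemma heavy_alternate:
  assumes h: "hole E n c"
  shows "\<not> (heavy c i \<and> heavy c (i + 1))"
proof
  assume "heavy c i \<and> heavy c (i + 1)"
  then obtain x y x' y' where "cls c i x" "cls c i y" "E x y" "cls c (i + 1) x'" "cls c (i + 1) y'"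
    "E x' y'"
    unfolding heavy_def by blast
  then show False using K4[of x y x' y'] cls_complete[OF h] sym by blast
qed

text \<open>Otherwise heavy and light classes would alternate around a cycle of odd length.\<close>

lemma two_light:
  assumes h: "hole E n c"
  obtains i where "\<not> heavy c i" "\<not> heavy c (i + 1)"
proof -
  have "\<exists>i. \<not> heavy c i \<and> \<not> heavy c (i + 1)"
  proof (rule ccontr)
    assume "\<not> ?thesis"
    then have alt: "heavy c (i + 1) \<longleftrightarrow> \<not> heavy c i" for i using heavy_alternate[OF h] by blast
    have "heavy c (int m) \<longleftrightarrow> (heavy c 0 \<longleftrightarrow> even m)" for m
      by (induction m) (use alt[of "int _"] in \<open>auto simp: add.commute\<close>)
    from this[of "nat n"] have "heavy c n \<longleftrightarrow> \<not> heavy c 0" using n by (auto simp: even_nat_iff)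
    moreover have "cls c n x \<longleftrightarrow> cls c 0 x" for x using cls_cong[OF h, of _ x] by auto
    then have "heavy c n \<longleftrightarrow> heavy c 0" by (simp only: heavy_def)
    ultimately show False by blast
  qed
  then show ?thesis using that by blast
qed

text \<open>The class and the hole vertex \<open>c (i + 1)\<close>, which sees all of it, form a
  proper subset of \<open>U\<close>, as \<open>c (i + 4)\<close> is missing. In a 3-colouring of it,
  the class uses only the two colours other than that of \<open>c (i + 1)\<close>. The value
  \<open>True\<close> on light classes will select the base colour.\<close>

lemma cls_two_colours:
  assumes h: "hole E n c"
  obtains b :: "'a \<Rightarrow> bool" where "\<And>x y. cls c i x \<Longrightarrow> cls c i y \<Longrightarrow> E x y \<Longrightarrow> b x \<noteq> b y"
    "\<And>x. \<not> heavy c i \<Longrightarrow> b x"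
proof (cases "heavy c i")
  case False
  then show ?thesis using that[of "\<lambda>_. True"] unfolding heavy_def by blast
next
  case True
  define W where "W = insert (c (i + 1)) {x. cls c i x}"
  have "W \<subseteq> U" unfolding W_def using hole_in[OF h] E_in cls_def by blast
  moreover have "c (i + 4) \<notin> W"
    using hole_eq[OF h, of "i + 4" "i + 1"] cls_unique[OF h, of i "c (i + 4)" "i + 4"] cls_self[OF
      h, of "i + 4"]
    by (auto simp: W_def)
  ultimately have "W \<subset> U" using hole_in[OF h] by blast
  from crit[OF this] obtain f :: "'a \<Rightarrow> nat" where
    f: "\<forall>x\<in>W. f x < 3" "\<forall>x\<in>W. \<forall>y\<in>W. E x y \<longrightarrow> f x \<noteq> f y"
    unfolding col_on_def by (elim exE conjE)
  define j :: nat where "j = (if f (c (i + 1)) = 0 then 1 else 0)"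
  show ?thesis
  proof (rule that[of "\<lambda>x. f x = j"])
    fix x y assume xy: "cls c i x" "cls c i y" "E x y"
    then have W: "x \<in> W" "y \<in> W" "c (i + 1) \<in> W" unfolding W_def by blast+
    moreover have "E x (c (i + 1))" "E y (c (i + 1))" using xy by (auto simp: cls_def)
    ultimately have "f x \<noteq> f y" "f x \<noteq> f (c (i + 1))" "f y \<noteq> f (c (i + 1))" using f(2) xy by blast+
    moreover have "f x < 3" "f y < 3" "f (c (i + 1)) < 3" using f(1) W by blast+
    ultimately show "(f x = j) \<noteq> (f y = j)" unfolding j_def by (auto split: if_splits)
  qed (use True in blast)
qed

text \<open>An edge in class \<open>2k + 1\<close> and the hole vertices at \<open>2k\<close> and
  \<open>2k + 2\<close> form a diamond. For \<open>n = 2p + 1\<close> the diamonds lead from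
  \<open>c 0\<close> to \<open>c (2p)\<close>, and the hole edge between these two closes a
  spindle.\<close>

lemma heavy_alternating_False:
  assumes h: "hole E n c" and heavy: "\<And>i. odd i \<Longrightarrow> 0 < i \<Longrightarrow> i < n \<Longrightarrow> heavy c i"
  shows False
proof -
  define p where "p = nat (n div 2)"
  have np: "n = 2 * int p + 1" using n by (simp add: p_def)
  have "\<forall>k. \<exists>x y. k < p \<longrightarrow> cls c (2 * int k + 1) x \<and> cls c (2 * int k + 1) y \<and> E x y"
    using heavy[of "2 * int _ + 1"] np unfolding heavy_def by fastforce
  then obtain X Y where XY: "\<And>k. k < p \<Longrightarrow> cls c (2 * int k + 1) (X k)"
    "\<And>k. k < p \<Longrightarrow> cls c (2 * int k + 1) (Y k)" "\<And>k. k < p \<Longrightarrow> E (X k) (Y k)" by metis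
  define u where "u m = (if m mod 3 = 0 then c (2 * int (m div 3))
    else if m mod 3 = 1 then X (m div 3) else Y (m div 3))" for m :: nat
  \<comment> \<open>\<open>e m\<close> is the position of the class of \<open>u m\<close>; classes
    being disjoint, it reduces injectivity of \<open>u\<close> to arithmetic.\<close>
  define e where "e m = 2 * int (m div 3) + (if m mod 3 = 0 then 0 else 1)" for m :: nat
  have u: "u (3 * k) = c (2 * int k)" "u (3 * k + 1) = X k" "u (3 * k + 2) = Y k"
    "u (3 * k + 3) = c (2 * int k + 2)" for k
  proof -
    have "(3 * k + 1) div 3 = k" "(3 * k + 2) div 3 = k" "(3 * k + 3) div 3 = k + 1"
      "(3 * k + 1) mod 3 = 1" "(3 * k + 2) mod 3 = 2" "(3 * k + 3) mod 3 = 0" by presburger+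
    then show "u (3 * k) = c (2 * int k)" "u (3 * k + 1) = X k" "u (3 * k + 2) = Y k"
      "u (3 * k + 3) = c (2 * int k + 2)"
      unfolding u_def by (simp_all only:) (simp_all add: algebra_simps)
  qed
  have div_less: "m div 3 < p" if "m \<in> {..3 * p}" "m mod 3 \<noteq> 0" for m
  proof -
    have "m \<noteq> 3 * p" using that(2) by auto
    then show ?thesis using that(1) by (auto simp: less_mult_imp_div_less)
  qed
  have ue: "cls c (e m) (u m)" if "m \<le> 3 * p" for m
  proof -
    show ?thesis using div_less[of m] that XY(1,2)[of "m div 3"] cls_self[OF h, of
      "2 * int (m div 3)"]
      by (auto simp: e_def u_def)
  qed
  have e: "0 \<le> e m" "e m < n" if "m \<le> 3 * p" for m
    using that unfolding e_def np by (auto split: if_splits) presburger+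
  have "inj_on u {..3 * p}"
  proof (rule inj_onI)
    fix m m' assume m: "m \<in> {..3 * p}" "m' \<in> {..3 * p}" and eq: "u m = u m'"
    have "n dvd e m - e m'" using cls_unique[OF h] ue[of m] ue[of m'] m eq by simp
    then have ee: "e m = e m'" using not_dvd[of "e m - e m'"] e[of m] e[of m'] m by fastforce
    have "even (e l) \<longleftrightarrow> l mod 3 = 0" "e l div 2 = int (l div 3)" for l by (simp_all add: e_def)
    then have d: "m div 3 = m' div 3" and z: "m mod 3 = 0 \<longleftrightarrow> m' mod 3 = 0"
      using ee by (metis of_nat_eq_iff, metis)
    have "m mod 3 = m' mod 3"
    proof (rule ccontr)
      assume ne: "m mod 3 \<noteq> m' mod 3"
      then have nz: "m mod 3 \<noteq> 0" "m' mod 3 \<noteq> 0" using z by auto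
      then have lt: "m div 3 < p" using div_less[OF m(1)] by blast
      have "m mod 3 = 1 \<and> m' mod 3 = 2 \<or> m mod 3 = 2 \<and> m' mod 3 = 1" using ne nz by presburger
      then have "X (m div 3) = Y (m div 3)" using eq d by (auto simp: u_def)
      then show False using XY(3)[OF lt] irrefl by simp
    qed
    then show "m = m'" using d by (metis div_mult_mod_eq)
  qed
  moreover have "E (u (3 * k)) (u (3 * k + 1)) \<and> E (u (3 * k)) (u (3 * k + 2)) \<and>
      E (u (3 * k + 1)) (u (3 * k + 2)) \<and> E (u (3 * k + 1)) (u (3 * k + 3)) \<and>
      E (u (3 * k + 2)) (u (3 * k + 3))" if "k < p" for k
    unfolding u using XY[OF that] sym by (simp add: cls_def add.assoc)
  ultimately have "\<not> E (u (3 * p)) (u 0)" using np n by (intro spindle) auto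
  moreover have "u (3 * p) = c (2 * int p)" "u 0 = c 0" using u(1)[of p] u(1)[of 0] by simp_all
  moreover have "E (c (2 * int p)) (c 0)" unfolding hole_adj[OF h] using np by simp
  ultimately show False by simp
qed

text \<open>Starting at a light position \<open>0\<close> preceded by a light one, the positions before the first light
  odd position \<open>k\<close> force colour \<open>0\<close> on the even positions; beyond \<open>k\<close> the two parities use the
  base colours \<open>1\<close> and \<open>2\<close>, and an edge inside a class uses \<open>0\<close> in addition.\<close>

lemma no_hole: "\<not> hole E n c"
proof
  assume "hole E n c"
  then obtain s where s: "\<not> heavy c s" "\<not> heavy c (s + 1)" using two_light by blast
  \<comment> \<open>The shift makes the positions \<open>-1\<close> and \<open>0\<close>
    light.\<close>
  define d where "d = (\<lambda>i. c (i + (s + 1)))"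
  have h: "hole E n d" unfolding d_def by (rule hole_shift) fact
  have hd: "heavy d i \<longleftrightarrow> heavy c (i + (s + 1))" for i by (simp add: heavy_def d_def cls_shift)
  have l0: "\<not> heavy d 0" using s(2) hd[of 0] by simp
  have "\<not> heavy d (-1)" using s(1) hd[of "-1"] by simp
  moreover have "cls d (n - 1) x \<Longrightarrow> cls d (-1) x" for x using cls_cong[OF h, of "n - 1" x "-1"] by
    simp
  ultimately have ln: "\<not> heavy d (n - 1)" unfolding heavy_def by blast
  have "\<exists>k. odd k \<and> 0 < k \<and> k < n \<and> \<not> heavy d k" using heavy_alternating_False[OF h] by blast
  then have ex: "\<exists>m. odd m \<and> int m < n \<and> \<not> heavy d (int m)"
    by (metis even_nat_iff int_nat_eq order_less_imp_le)
  define k where "k = (LEAST m. odd m \<and> int m < n \<and> \<not> heavy d (int m))"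
  have k: "odd k" "int k < n" "\<not> heavy d (int k)" using LeastI_ex[OF ex] unfolding k_def by blast+
  have less: "heavy d (int m)" if "odd m" "m < k" for m
    using not_less_Least[of m "\<lambda>m. odd m \<and> int m < n \<and> \<not> heavy d (int m)"] that k(2)
    unfolding k_def[symmetric] by auto
  have heavy_odd: "heavy d i" if "odd i" "0 \<le> i" "i < int k" for i
    using less[of "nat i"] that by (auto simp: even_nat_iff)
  have light_even: "\<not> heavy d i" if "even i" "0 \<le> i" "i < int k" for i
    using l0 heavy_odd[of "i - 1"] heavy_alternate[OF h, of "i - 1"] that
    by (cases "i = 0") auto
  have "\<forall>i. \<exists>b :: 'a \<Rightarrow> bool. (\<forall>x y. cls d i x \<longrightarrow> cls d i y \<longrightarrow> E x y \<longrightarrow> b x \<noteq> b y) \<and>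
      (\<not> heavy d i \<longrightarrow> (\<forall>x. b x))"
    using cls_two_colours[OF h] by metis
  then obtain b :: "int \<Rightarrow> 'a \<Rightarrow> bool" where
    b: "\<And>i x y. cls d i x \<Longrightarrow> cls d i y \<Longrightarrow> E x y \<Longrightarrow> b i x \<noteq> b i y" "\<And>i x. \<not> heavy d i \<Longrightarrow> b i x"
    by metis
  have "\<forall>x. \<exists>i. x \<in> U \<longrightarrow> 0 \<le> i \<and> i < n \<and> cls d i x"
  proof
    fix x
    show "\<exists>i. x \<in> U \<longrightarrow> 0 \<le> i \<and> i < n \<and> cls d i x"
    proof (cases "x \<in> U")
      case True
      then obtain i where i: "cls d i x" using cls_all[OF h] by blast
      have "n dvd i - i mod n" by (rule dvd_minus_mod)
      then have "cls d (i mod n) x" by (rule cls_cong[OF h i])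
      moreover have "0 \<le> i mod n" "i mod n < n" using n by simp_all
      ultimately show ?thesis by blast
    qed blast
  qed
  then obtain idx where idx: "\<And>x. x \<in> U \<Longrightarrow> 0 \<le> idx x \<and> idx x < n \<and> cls d (idx x) x" by metis
  define col :: "int \<Rightarrow> bool \<Rightarrow> nat" where
    "col i t = (if i < int k then (if even i then 0 else if t then 1 else 2)
      else if odd i then (if t then 1 else 0) else (if t then 2 else 0))" for i t
  \<comment> \<open>Below \<open>k\<close> the colour 0 at even positions faces 1 or 2 at odd ones.
    At the change of scheme, 0 meets the base colour 1 of the light class \<open>k\<close>. From
    \<open>k\<close> on, one of two consecutive classes is light and avoids 0, and the base colours
    differ.\<close>
  have step: "col i t \<noteq> col (i + 1) t'"
    if "0 \<le> i" "i + 1 < n" and t: "\<not> heavy d i \<Longrightarrow> t" "\<not> heavy d (i + 1) \<Longrightarrow> t'" for i t t'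
  proof (cases "i < int k")
    case True
    show ?thesis
    proof (cases "i + 1 = int k")
      case True
      then show ?thesis using k(1,3) t(2) by (auto simp: col_def) presburger+
    next
      case False
      then show ?thesis using True by (auto simp: col_def)
    qed
  next
    case False
    then show ?thesis using t heavy_alternate[OF h, of i] by (auto simp: col_def)
  qed
  have "col_on E 3 U" unfolding col_on_def
  proof (intro exI[of _ "\<lambda>x. col (idx x) (b (idx x) x)"] conjI ballI impI)
    fix x show "col (idx x) (b (idx x) x) < 3" by (simp add: col_def)
  next
    fix x y assume xy: "x \<in> U" "y \<in> U" "E x y"
    note ix = idx[OF xy(1)] and iy = idx[OF xy(2)]
    let ?i = "idx x" and ?j = "idx y"
    \<comment> \<open>Position \<open>n - 1\<close> is even, light and not below \<open>k\<close>,
      so it has colour 2, while position 0 has colour 0.\<close>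
    have wrap: "col 0 t \<noteq> col (n - 1) (b (n - 1) z)" for t z
    proof -
      have "0 < int k" "even (n - 1)" using k(1) n by (auto intro: Nat.gr0I)
      moreover have "b (n - 1) z" by (rule b(2)[OF ln])
      moreover have "\<not> n - 1 < int k" using k(2) by simp
      ultimately show ?thesis by (simp add: col_def)
    qed
    have "?i = ?j \<or> ?j = ?i + 1 \<or> ?i = ?j + 1 \<or> (?i = 0 \<and> ?j = n - 1) \<or> (?j = 0 \<and> ?i = n - 1)"
    proof -
      consider "n dvd ?i - ?j" | "n dvd ?i - ?j - 1" | "n dvd ?i - ?j + 1"
        using cls_adj[OF h _ _ xy(3)] ix iy by blast
      then show ?thesis
      proof cases
        case 1
        then show ?thesis using not_dvd[of "?i - ?j"] ix iy by linarith
      next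
        case 2
        then show ?thesis
          using not_dvd[of "?i - ?j - 1"] ix iy by linarith
      next
        case 3
        then show ?thesis
          using not_dvd[of "?i - ?j + 1"] ix iy by linarith
      qed
    qed
    then consider "?i = ?j" | "?j = ?i + 1" | "?i = ?j + 1" | "?i = 0" "?j = n - 1" | "?j = 0"
      "?i = n - 1"
      by blast
    then show "col ?i (b ?i x) \<noteq> col ?j (b ?j y)"
    proof cases
      case 1
      have "heavy d ?i" using ix iy xy(3) 1 unfolding heavy_def by metis
      then have "\<not> (even ?i \<and> ?i < int k)" using light_even ix by blast
      moreover have "b ?i x \<noteq> b ?i y" using b(1)[of ?i x y] ix iy xy(3) 1 by simp
      ultimately show ?thesis unfolding 1[symmetric] by (auto simp: col_def)
    next
      case 2
      then show ?thesis using step[of ?i "b ?i x" "b ?j y"] b(2) ix iy by simp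
    next
      case 3
      then show ?thesis using step[of ?j "b ?j y" "b ?i x"] b(2) ix iy by (metis add.commute)
    next
      case 4
      then show ?thesis using wrap by metis
    next
      case 5
      then show ?thesis using wrap by metis
    qed
  qed
  then show False using noncol by contradiction
qed

end

context critical_S
begin

text \<open>A smallest counterexample contains an odd hole. Its length is at least 7 because
  \<open>C5\<close> is excluded, and at most the size of the counterexample, which is the minimality
  that \<open>shortest_odd_hole\<close> asks for.\<close>

lemma bipartite_if_triangle_free:
  assumes "S \<subseteq> U" "\<And>x y z. x \<in> S \<Longrightarrow> y \<in> S \<Longrightarrow> z \<in> S \<Longrightarrow> E x y \<Longrightarrow> E y z \<Longrightarrow> \<not> E x z"
  shows "col_on E 2 S"
proof (rule ccontr)
  assume "\<not> col_on E 2 S"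
  define bad where "bad T \<longleftrightarrow> T \<subseteq> U \<and> \<not> col_on E 2 T \<and>
    (\<forall>x\<in>T. \<forall>y\<in>T. \<forall>z\<in>T. E x y \<longrightarrow> E y z \<longrightarrow> \<not> E x z)" for T
  have "bad S" using assms \<open>\<not> col_on E 2 S\<close> unfolding bad_def by blast
  define T where "T = arg_min card bad"
  have T: "bad T" unfolding T_def by (rule arg_min_natI[of bad, OF \<open>bad S\<close>])
  have min: "card T \<le> card W" if "bad W" for W
    unfolding T_def by (rule arg_min_nat_le[of bad, OF that])
  have TU: "T \<subseteq> U" and Tn: "\<not> col_on E 2 T" using T by (simp_all add: bad_def)
  have Tt: "\<not> E x z" if "x \<in> T" "y \<in> T" "z \<in> T" "E x y" "E y z" for x y z
    using T that unfolding bad_def by blast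
  obtain n c where c: "odd n" "5 \<le> n" "hole E n c" "range c \<subseteq> T"
    by (rule odd_hole_exists[OF Tn sym irrefl Tt]) blast
  have adj: "E (c i) (c j) \<longleftrightarrow> n dvd i - j - 1 \<or> n dvd i - j + 1" for i j
    using c(3) by (simp add: hole_def)
  have "n \<noteq> 5"
  proof
    assume "n = 5"
    then show False
      using C5[of "c 0" "c 1" "c 2" "c 3" "c 4"] by (simp add: adj)
  qed
  then have n7: "7 \<le> n" using c(1,2) by presburger
  have "inj_on c {0..<n}"
  proof (rule inj_onI)
    fix i j assume "i \<in> {0..<n}" "j \<in> {0..<n}" "c i = c j"
    then have "n dvd i - j" "\<bar>i - j\<bar> < n" using c(3) by (auto simp: hole_def)
    then show "i = j" using dvd_imp_le_int[of "i - j" n] c(2) by auto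
  qed
  then have "nat n = card (c ` {0..<n})" by (simp add: card_image)
  also have "\<dots> \<le> card T"
    using c(4) finite_subset[OF TU fin] by (intro card_mono) auto
  finally have nT: "nat n \<le> card T" .
  interpret shortest_odd_hole U E n
  proof
    show "n \<le> int (card W)" if "W \<subseteq> U" "\<not> col_on E 2 W"
      "\<And>x y z. x \<in> W \<Longrightarrow> y \<in> W \<Longrightarrow> z \<in> W \<Longrightarrow> E x y \<Longrightarrow> E y z \<Longrightarrow> \<not> E x z" for W
    proof -
      have "bad W" using that unfolding bad_def by blast
      then show ?thesis using min[of W] nT by linarith
    qed
  qed (use c(1) n7 in auto)
  show False using no_hole c(3) by blast
qed

end

subsection \<open>Critical graphs whose triangle-free parts are bipartite\<close>

lemma col_on_2_iff:
  "col_on E 2 S \<longleftrightarrow> (\<exists>g :: 'a \<Rightarrow> bool. \<forall>x\<in>S. \<forall>y\<in>S. E x y \<longrightarrow> g x \<noteq> g y)"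
proof
  assume "col_on E 2 S"
  then obtain f :: "'a \<Rightarrow> nat" where f: "\<forall>x\<in>S. f x < 2" "\<forall>x\<in>S. \<forall>y\<in>S. E x y \<longrightarrow> f x \<noteq> f y"
    unfolding col_on_def by blast
  then show "\<exists>g :: 'a \<Rightarrow> bool. \<forall>x\<in>S. \<forall>y\<in>S. E x y \<longrightarrow> g x \<noteq> g y"
    by (intro exI[of _ "\<lambda>x. f x = 0"]) (metis less_2_cases_iff)
next
  assume "\<exists>g :: 'a \<Rightarrow> bool. \<forall>x\<in>S. \<forall>y\<in>S. E x y \<longrightarrow> g x \<noteq> g y"
  then obtain g :: "'a \<Rightarrow> bool" where g: "\<forall>x\<in>S. \<forall>y\<in>S. E x y \<longrightarrow> g x \<noteq> g y" by blast
  show "col_on E 2 S" unfolding col_on_def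
    by (rule exI[of _ "\<lambda>x. if g x then 0 else 1"]) (use g in auto)
qed

text \<open>Connectivity by cuts instead of paths: a property that changes on \<open>X\<close>
  changes along an edge of \<open>X\<close>.\<close>

definition conn :: "('a \<Rightarrow> 'a \<Rightarrow> bool) \<Rightarrow> 'a set \<Rightarrow> bool" where
  "conn E X \<longleftrightarrow> (\<forall>Y\<subseteq>X. Y \<noteq> {} \<longrightarrow> Y \<noteq> X \<longrightarrow> (\<exists>y\<in>Y. \<exists>x\<in>X - Y. E y x))"

lemma conn_crossing:
  assumes "conn E X" "x \<in> X" "P x" "y \<in> X" "\<not> P y"
  obtains a b where "a \<in> X" "b \<in> X" "E a b" "P a" "\<not> P b"
proof -
  have "\<exists>a\<in>{z\<in>X. P z}. \<exists>b\<in>X - {z\<in>X. P z}. E a b"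
    using assms(1)[unfolded conn_def, rule_format, of "{z\<in>X. P z}"] assms(2-) by blast
  then show ?thesis using that by blast
qed

lemma component:
  assumes sym: "\<And>x y. E x y \<Longrightarrow> E y x" and "r \<in> S"
  obtains X where "X \<subseteq> S" "r \<in> X" "conn E X" "\<And>x y. x \<in> X \<Longrightarrow> y \<in> S \<Longrightarrow> E x y \<Longrightarrow> y \<in> X"
proof
  define R where "R = {(a, b). a \<in> S \<and> b \<in> S \<and> E a b}"
  define X where "X = {x. (r, x) \<in> R\<^sup>*}"
  have XS: "x \<in> S" if "(r, x) \<in> R\<^sup>*" for x
    using that by (induction rule: rtrancl_induct) (use \<open>r \<in> S\<close> R_def in auto)
  show "X \<subseteq> S" using XS X_def by blast
  show "r \<in> X" by (simp add: X_def)
  show "y \<in> X" if "x \<in> X" "y \<in> S" "E x y" for x y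
    using that XS[of x] unfolding X_def R_def by (auto intro: rtrancl_into_rtrancl)
  show "conn E X" unfolding conn_def
  proof (intro allI impI, rule ccontr)
    fix Y assume Y: "Y \<subseteq> X" "Y \<noteq> {}" "Y \<noteq> X" and no: "\<not> (\<exists>y\<in>Y. \<exists>x\<in>X - Y. E y x)"
    have "x \<in> Y \<longleftrightarrow> r \<in> Y" if "(r, x) \<in> R\<^sup>*" for x
      using that
    proof (induction rule: rtrancl_induct)
      case (step x y)
      then have "x \<in> X" "y \<in> X" "E x y" "E y x"
        unfolding X_def using sym R_def by (auto intro: rtrancl_into_rtrancl)
      then show ?case using no step by blast
    qed simp
    then show False using Y unfolding X_def by blast
  qed
qed

section \<open>Analogues of facts about minimal imperfect graphs\<close>

locale critical_bip = critical +
  assumes bip: "S \<subseteq> U \<Longrightarrow>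
    (\<And>x y z. x \<in> S \<Longrightarrow> y \<in> S \<Longrightarrow> z \<in> S \<Longrightarrow> E x y \<Longrightarrow> E y z \<Longrightarrow> \<not> E x z) \<Longrightarrow> col_on E 2 S"
begin

lemma bip_ex:
  assumes "S \<subseteq> U" "\<And>x y z. x \<in> S \<Longrightarrow> y \<in> S \<Longrightarrow> z \<in> S \<Longrightarrow> E x y \<Longrightarrow> E y z \<Longrightarrow> \<not> E x z"
  shows "\<exists>g :: 'a \<Rightarrow> bool. \<forall>x\<in>S. \<forall>y\<in>S. E x y \<longrightarrow> g x \<noteq> g y"
  using bip[OF assms] unfolding col_on_2_iff .

text \<open>The vertices outside \<open>I\<close> are triangle-free, hence 2-colourable, and
  \<open>I\<close> takes the third colour. The model is that no stable set of a minimal imperfect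
  graph meets all maximum cliques.\<close>

lemma independent_transversal:
  assumes I: "\<And>x y. x \<in> I \<Longrightarrow> y \<in> I \<Longrightarrow> \<not> E x y"
    and tri: "\<And>x y z. E x y \<Longrightarrow> E y z \<Longrightarrow> E x z \<Longrightarrow> x \<in> I \<or> y \<in> I \<or> z \<in> I"
  shows False
proof -
  have "\<not> E x z" if "x \<in> U - I" "y \<in> U - I" "z \<in> U - I" "E x y" "E y z" for x y z
    using tri[of x y z] that by auto
  from bip_ex[OF Diff_subset this]
  obtain g :: "'a \<Rightarrow> bool" where g: "\<forall>x\<in>U - I. \<forall>y\<in>U - I. E x y \<longrightarrow> g x \<noteq> g y" ..
  have "col_on E 3 U" unfolding col_on_def
  proof (intro exI[of _ "\<lambda>x. if x \<in> I then 2 else if g x then 0 else 1"] conjI ballI impI)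
    fix x y assume "x \<in> U" "y \<in> U" "E x y"
    then show "(if x \<in> I then 2 else if g x then 0 else 1 :: nat) \<noteq>
        (if y \<in> I then 2 else if g y then 0 else 1)"
      using I[of x y] g by (cases "x \<in> I"; cases "y \<in> I") auto
  qed auto
  then show False using noncol by contradiction
qed

lemma col_minus:
  assumes "v \<in> U"
  obtains f :: "'a \<Rightarrow> nat" where "\<forall>x\<in>U - {v}. f x < 3"
    "\<forall>x\<in>U - {v}. \<forall>y\<in>U - {v}. E x y \<longrightarrow> f x \<noteq> f y"
proof -
  have "U - {v} \<subset> U" using assms by blast
  from crit[OF this] show ?thesis unfolding col_on_def using that by (elim exE conjE)
qed

text \<open>Otherwise the third colour class would meet all triangles.\<close>

lemma Kempe:
  assumes "v \<in> U" and f3: "\<forall>x\<in>U - {v}. f x < (3 :: nat)"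
    and fE: "\<forall>x\<in>U - {v}. \<forall>y\<in>U - {v}. E x y \<longrightarrow> f x \<noteq> f y"
    and ij: "i < 3" "j < 3" "i \<noteq> j"
  obtains x y where "E v x" "E v y" "E x y" "f x = i" "f y = j"
proof -
  have f: "\<And>x. x \<in> U - {v} \<Longrightarrow> f x < 3"
    "\<And>x y. x \<in> U - {v} \<Longrightarrow> y \<in> U - {v} \<Longrightarrow> E x y \<Longrightarrow> f x \<noteq> f y"
    using f3 fE by blast+
  have "\<exists>k<3. k \<noteq> i \<and> k \<noteq> j \<and> (\<forall>l<3. l = i \<or> l = j \<or> l = k)"
    by (rule exI[of _ "3 - i - j"]) (use ij in \<open>auto simp: less_Suc_eq numeral_3_eq_3\<close>)
  then obtain k where k: "k < 3" "k \<noteq> i" "k \<noteq> j" "\<And>l. l < 3 \<Longrightarrow> l = i \<or> l = j \<or> l = k" by blast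
  define I where "I = {x \<in> U - {v}. f x = k}"
  have "\<exists>x y z. E x y \<and> E y z \<and> E x z \<and> x \<notin> I \<and> y \<notin> I \<and> z \<notin> I"
    using independent_transversal[of I] f(2) unfolding I_def by blast
  then obtain x y z where xyz: "E x y" "E y z" "E x z" "x \<notin> I" "y \<notin> I" "z \<notin> I" by blast
  have vcase: "(f a = i \<and> f b = j) \<or> (f a = j \<and> f b = i)"
    if "E v a" "E v b" "E a b" "a \<notin> I" "b \<notin> I" for a b
  proof -
    have ab: "a \<in> U - {v}" "b \<in> U - {v}" using that E_in' irrefl by blast+
    then have "f a \<noteq> k" "f b \<noteq> k" using that(4,5) by (simp_all add: I_def)
    then show ?thesis using k(4)[OF f(1)] f(2)[of a b] ab that(3) by metis
  qed
  have "v = x \<or> v = y \<or> v = z"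
  proof (rule ccontr)
    assume "\<not> ?thesis"
    then have m: "x \<in> U - {v}" "y \<in> U - {v}" "z \<in> U - {v}" using xyz E_in E_in' by blast+
    then have "f x \<noteq> k" "f y \<noteq> k" "f z \<noteq> k" using xyz(4-6) by (simp_all add: I_def)
    then have "f x = i \<or> f x = j" "f y = i \<or> f y = j" "f z = i \<or> f z = j"
      using k(4)[OF f(1)] m by metis+
    then show False using f(2)[OF m(1,2) xyz(1)] f(2)[OF m(2,3) xyz(2)] f(2)[OF m(1,3) xyz(3)] by
      auto
  qed
  then obtain a b where "E v a" "E v b" "E a b" "a \<notin> I" "b \<notin> I"
    using xyz sym by blast
  then show ?thesis using vcase[of a b] that[of a b] that[of b a] sym by blast
qed

text \<open>Completeness keeps the colours of \<open>A\<close> and \<open>B\<close> apart. Two of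
  the three colours thus lie on the same side, yet by \<open>Kempe\<close> any two occur at the ends
  of an edge between the sides.\<close>

lemma nbh_not_complete_bipartite:
  assumes "v \<in> U" and A: "\<And>x. x \<in> A \<Longrightarrow> E v x" and B: "\<And>x. x \<in> B \<Longrightarrow> E v x"
    and AB: "\<And>x y. x \<in> A \<Longrightarrow> y \<in> B \<Longrightarrow> E x y"
    and edges: "\<And>x y. E v x \<Longrightarrow> E v y \<Longrightarrow> E x y \<Longrightarrow> (x \<in> A \<and> y \<in> B) \<or> (x \<in> B \<and> y \<in> A)"
  shows False
proof -
  obtain f :: "'a \<Rightarrow> nat" where f: "\<forall>x\<in>U - {v}. f x < 3"
    "\<forall>x\<in>U - {v}. \<forall>y\<in>U - {v}. E x y \<longrightarrow> f x \<noteq> f y"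
    using col_minus[OF assms(1)] by blast
  have N: "x \<in> U - {v}" if "E v x" for x using that E_in' irrefl by blast
  have ne: "f x \<noteq> f y" if "x \<in> A" "y \<in> B" for x y
    using f(2) N[OF A] N[OF B] AB that by blast
  obtain x0 x1 where 1: "E v x0" "E v x1" "E x0 x1" "f x0 = 0" "f x1 = 1"
    by (rule Kempe[OF assms(1) f, of 0 1]) simp_all
  obtain y0 y2 where 2: "E v y0" "E v y2" "E y0 y2" "f y0 = 0" "f y2 = 2"
    by (rule Kempe[OF assms(1) f, of 0 2]) simp_all
  obtain z1 z2 where 3: "E v z1" "E v z2" "E z1 z2" "f z1 = 1" "f z2 = 2"
    by (rule Kempe[OF assms(1) f, of 1 2]) simp_all
  show False
    using edges[OF 1(1-3)] edges[OF 2(1-3)] edges[OF 3(1-3)] ne 1(4,5) 2(4,5) 3(4,5) by metis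
qed

text \<open>Chvatal's argument: colour the graph without \<open>A\<close> and the graph without
  \<open>B\<close>, and unite the two colour classes of \<open>v\<close>. The union has no vertex of
  the cutset except \<open>v\<close>, so it is independent; a triangle avoids \<open>A\<close> or
  \<open>B\<close>, uses all three colours there and so meets the union.\<close>

lemma no_star_cutset:
  assumes "v \<in> U" "v \<notin> A" "v \<notin> B" "A \<inter> B = {}" "A \<noteq> {}" "B \<noteq> {}" "A \<subseteq> U" "B \<subseteq> U"
    and S: "\<And>x. x \<in> U \<Longrightarrow> x \<notin> A \<Longrightarrow> x \<notin> B \<Longrightarrow> x = v \<or> E v x"
    and AB: "\<And>x y. x \<in> A \<Longrightarrow> y \<in> B \<Longrightarrow> \<not> E x y"
  shows False
proof -
  have "U - A \<subset> U" "U - B \<subset> U" using assms by blast+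
  from this[THEN crit] obtain f g :: "'a \<Rightarrow> nat" where
    f: "\<forall>x\<in>U - A. f x < 3" "\<forall>x\<in>U - A. \<forall>y\<in>U - A. E x y \<longrightarrow> f x \<noteq> f y" and
    g: "\<forall>x\<in>U - B. g x < 3" "\<forall>x\<in>U - B. \<forall>y\<in>U - B. E x y \<longrightarrow> g x \<noteq> g y"
    unfolding col_on_def by (elim exE conjE)
  define I where "I = {x \<in> U - A. f x = f v} \<union> {x \<in> U - B. g x = g v}"
  have vI: "v \<in> U - A" "v \<in> U - B" using assms by auto
  have AB': "x \<notin> A \<or> y \<notin> B" "x \<notin> B \<or> y \<notin> A" if "E x y" for x y
    using that AB sym by blast+
  have Sv: "x = v" if "x \<in> I" "x \<notin> A" "x \<notin> B" for x
  proof (rule ccontr)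
    assume "x \<noteq> v"
    then have "E v x" using S[of x] that unfolding I_def by auto
    moreover have "x \<in> U - A" "x \<in> U - B" using that unfolding I_def by auto
    ultimately have "f v \<noteq> f x" "g v \<noteq> g x" using f(2) g(2) vI by auto
    then show False using that(1) unfolding I_def by auto
  qed
  show False
  proof (rule independent_transversal[of I])
    fix x y assume xy: "x \<in> I" "y \<in> I"
    show "\<not> E x y"
    proof
      assume E: "E x y"
      have U: "x \<in> U" "y \<in> U" using xy by (auto simp: I_def)
      have f1: "f z = f v" if "z \<in> I" "z \<notin> A" for z using that Sv[of z] unfolding I_def by auto
      have g1: "g z = g v" if "z \<in> I" "z \<notin> B" for z using that Sv[of z] unfolding I_def by auto
      show False
      proof (cases "x \<in> A \<or> y \<in> A")
        case True
        then have "x \<in> U - B" "y \<in> U - B" using AB'[OF E] assms(4) U Sv[OF xy(1)] Sv[OF xy(2)]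
          xy unfolding I_def by auto
        then have "g x \<noteq> g y" "g x = g v" "g y = g v" using g(2) E g1 xy by blast+
        then show False by simp
      next
        case False
        then have "f x \<noteq> f y" "f x = f v" "f y = f v" using f(2) E f1 xy U by blast+
        then show False by simp
      qed
    qed
  next
    fix x y z assume t: "E x y" "E y z" "E x z"
    have three: "a = d \<or> b = d \<or> c = d"
      if "a < 3" "b < 3" "c < 3" "d < 3" "a \<noteq> b" "b \<noteq> c" "a \<noteq> c" for a b c d :: nat
      using that by linarith
    show "x \<in> I \<or> y \<in> I \<or> z \<in> I"
    proof (cases "x \<in> A \<or> y \<in> A \<or> z \<in> A")
      case True
      then have m: "x \<in> U - B" "y \<in> U - B" "z \<in> U - B"
        using AB'[OF t(1)] AB'[OF t(2)] AB'[OF t(3)] assms(4) E_in[OF t(1)] E_in[OF t(2)] E_in'[OF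
          t(2)]
        by blast+
      then have "g x = g v \<or> g y = g v \<or> g z = g v"
        using three[of "g x" "g y" "g z" "g v"] g t vI by blast
      then show ?thesis using m unfolding I_def by blast
    next
      case False
      then have m: "x \<in> U - A" "y \<in> U - A" "z \<in> U - A" using t E_in E_in' by blast+
      then have "f x = f v \<or> f y = f v \<or> f z = f v"
        using three[of "f x" "f y" "f z" "f v"] f t vI by blast
      then show ?thesis using m unfolding I_def by blast
    qed
  qed
qed

text \<open>A connected set \<open>X\<close> with at least two vertices whose mixed neighbours are all attached to \<open>t\<close>
  behaves like a homogeneous set: on one side of \<open>X\<close> there are no mixed neighbours, so that the
  neighbourhoods there are complete bipartite.\<close>

lemma no_clone_component:
  assumes X: "conn E X" "X \<subseteq> U" "r \<in> X" "z \<in> X" "E r z"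
    and s: "\<And>x. x \<in> X \<Longrightarrow> E s x" and st: "E s t" and t: "\<And>x. x \<in> X \<Longrightarrow> \<not> E t x"
    and mixed: "\<And>w x y. w \<notin> X \<Longrightarrow> x \<in> X \<Longrightarrow> y \<in> X \<Longrightarrow> E x y \<Longrightarrow> E w x \<Longrightarrow> \<not> E w y \<Longrightarrow>
      E w t \<and> \<not> E w s"
  shows False
proof -
  have tri: "\<not> E x z" if "x \<in> X" "y \<in> X" "z \<in> X" "E x y" "E y z" for x y z
    using K4[of s x y z] s[OF that(1)] s[OF that(2)] s[OF that(3)] that sym by blast
  have "\<exists>h :: 'a \<Rightarrow> bool. \<forall>x\<in>X. \<forall>y\<in>X. E x y \<longrightarrow> h x \<noteq> h y"
    by (rule bip_ex[OF X(2) tri])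
  then obtain h :: "'a \<Rightarrow> bool" where h: "\<And>x y. x \<in> X \<Longrightarrow> y \<in> X \<Longrightarrow> E x y \<Longrightarrow> h x \<noteq> h y" by blast
  \<comment> \<open>The mixed vertices. By connectivity of \<open>X\<close> they distinguish the
    ends of an edge, where \<open>mixed\<close> applies.\<close>
  define M where "M w \<longleftrightarrow> w \<notin> X \<and> (\<exists>x\<in>X. E w x) \<and> (\<exists>y\<in>X. \<not> E w y)" for w
  have M: "E w t" "\<not> E w s" "w \<notin> X" if Mw: "M w" for w
  proof -
    obtain x y where xy: "x \<in> X" "E w x" "y \<in> X" "\<not> E w y" and w: "w \<notin> X"
      using Mw unfolding M_def by blast
    obtain a b where "a \<in> X" "b \<in> X" "E a b" "E w a" "\<not> E w b"
      using conn_crossing[of E X x "E w" y] X(1) xy by blast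
    then show "E w t" "\<not> E w s" "w \<notin> X" using mixed[OF w] w by blast+
  qed
  \<comment> \<open>Moving from an edge inside the neighbourhood of \<open>w\<close> towards a
    non-neighbour leads to a triangle \<open>w, a, b\<close> and a vertex \<open>c\<close> seeing
    only \<open>a\<close> of it; with \<open>t\<close> at \<open>w\<close> this is a bull.\<close>
  have ind: "\<not> E x y" if w: "M w" and xy: "x \<in> X" "y \<in> X" "E w x" "E w y" for w x y
  proof
    assume "E x y"
    define P where "P a \<longleftrightarrow> E w a \<and> (\<exists>b\<in>X. E w b \<and> E a b)" for a
    obtain y' where "y' \<in> X" "\<not> E w y'" using w M_def by blast
    then obtain a c where ac: "a \<in> X" "c \<in> X" "E a c" "P a" "\<not> P c"
      using conn_crossing[of E X x P y'] X(1) xy \<open>E x y\<close> unfolding P_def by blast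
    then obtain b where b: "b \<in> X" "E w b" "E a b" "E w a" unfolding P_def by blast
    have "\<not> E w c" using ac b sym unfolding P_def by blast
    moreover have "\<not> E b c" using tri[of b a c] ac b sym by blast
    ultimately have "E t c" using bull[of w a b t c] b M(1)[OF w] t ac sym by blast
    then show False using t ac by blast
  qed
  have tU: "t \<in> U" using st by (rule E_in')
  \<comment> \<open>The 2-colouring of the connected set \<open>X\<close> is unique up to exchanging
    the colours.\<close>
  have agree: "(\<forall>x\<in>X. g x = h x) \<or> (\<forall>x\<in>X. g x \<noteq> h x)"
    if "\<And>x y. x \<in> X \<Longrightarrow> y \<in> X \<Longrightarrow> E x y \<Longrightarrow> g x \<noteq> g y" for g :: "'a \<Rightarrow> bool"
  proof (rule ccontr)
    assume "\<not> ?thesis"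
    then obtain a b where "a \<in> X" "g a = h a" "b \<in> X" "g b \<noteq> h b" by blast
    then obtain x y where "x \<in> X" "y \<in> X" "E x y" "g x = h x" "g y \<noteq> h y"
      using conn_crossing[of E X a "\<lambda>x. g x = h x" b] X(1) by blast
    then show False using that[of x y] h[of x y] by auto
  qed
  have side: "h x = h y" if w: "M w" and xy: "x \<in> X" "y \<in> X" "E w x" "E w y" for w x y
  proof -
    have "insert w X \<subseteq> U" using X(2) E_in xy by blast
    moreover have "\<not> E a c" if abc: "a \<in> insert w X" "b \<in> insert w X" "c \<in> insert w X" "E a b"
      "E b c" for a b c
    proof
      assume "E a c"
      have one: "\<not> (E w p \<and> E w q \<and> E p q)" if "p \<in> insert w X" "q \<in> insert w X" for p q
        using ind[OF w, of p q] that irrefl by auto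
      have E': "E b a" "E c b" "E c a" using abc \<open>E a c\<close> by (blast intro: sym)+
      show False
        using one[of b c] one[of a c] one[of a b] tri[of a b c] abc \<open>E a c\<close> E' by auto
    qed
    ultimately have "\<exists>g :: 'a \<Rightarrow> bool. \<forall>x\<in>insert w X. \<forall>y\<in>insert w X. E x y \<longrightarrow> g x \<noteq> g y"
      by (rule bip_ex)
    then obtain g :: "'a \<Rightarrow> bool" where g:
      "\<And>x y. x \<in> insert w X \<Longrightarrow> y \<in> insert w X \<Longrightarrow> E x y \<Longrightarrow> g x \<noteq> g y"
      by blast
    have "g x = g y" using g[of w x] g[of w y] xy by auto
    then show ?thesis using agree[of g] g xy by blast
  qed
  \<comment> \<open>Neighbours on different sides would give a prism or a bull if \<open>w\<close>
    and \<open>w'\<close> are adjacent, and otherwise an odd cycle through \<open>w, t, w'\<close>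
    in the triangle-free set \<open>?S\<close>.\<close>
  have same: "h x = h y" if w: "M w" "M w'" and xy: "x \<in> X" "y \<in> X" "E w x" "E w' y" for w w' x y
  proof (rule ccontr)
    assume hxy: "h x \<noteq> h y"
    have cr: "\<not> E w y" "\<not> E w' x" using side w xy hxy by blast+
    have disj: "\<not> (E w a \<and> E w' a)" if "a \<in> X" for a
      using side[OF w(1), of a x] side[OF w(2), of a y] that xy hxy by auto
    show False
    proof (cases "E w w'")
      case True
      show False
      proof (cases "E x y")
        case True
        have "prism x y s w w' t" unfolding prism_def
          using True \<open>E w w'\<close> xy s st t M w cr sym by blast
        then show False using no_prism by blast
      next
        case False
        then show False using bull[of w w' t x y] \<open>E w w'\<close> xy cr M w t sym by blast
      qed
    next
      case False
      let ?S = "insert w (insert w' (insert t X))"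
      have "?S \<subseteq> U" using X(2) xy E_in tU by blast
      moreover have "\<not> E a c" if abc: "a \<in> ?S" "b \<in> ?S" "c \<in> ?S" "E a b" "E b c" for a b c
      proof
        assume "E a c"
        have "\<not> E w' w" using False sym by blast
        then have ww: "E p q \<Longrightarrow> p \<in> {w, w', t} \<Longrightarrow> q \<in> {w, w', t} \<Longrightarrow> p = t \<or> q = t" for p q
          using False irrefl by auto
        have E': "E b a" "E c b" "E c a" using abc \<open>E a c\<close> by (blast intro: sym)+
        have tx: "E t q \<Longrightarrow> q \<in> ?S \<Longrightarrow> q \<in> {w, w'}" for q using t irrefl by auto
        have no_t: "\<not> (E t p \<and> E t q \<and> E p q)" if "p \<in> ?S" "q \<in> ?S" for p q
          using ww[of p q] tx[of p] tx[of q] that irrefl by auto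
        have "a \<noteq> t" "b \<noteq> t" "c \<noteq> t" using no_t[of b c] no_t[of a c] no_t[of a b] abc \<open>E a c\<close> E' by
          blast+
        moreover have one: "\<not> (E p q \<and> E p l \<and> E q l)" if "p \<in> {w, w'}" "q \<in> ?S" "l \<in> ?S" "q \<noteq> t"
          "l \<noteq> t" "p \<noteq> t" for p q l
          using that ww[of p q] ww[of p l] ind[OF w(1), of q l] ind[OF w(2), of q l] by auto
        ultimately show False
          using one[of a b c] one[of b a c] one[of c a b] tri[of a b c] abc \<open>E a c\<close> E' by auto
      qed
      ultimately have "\<exists>g :: 'a \<Rightarrow> bool. \<forall>x\<in>?S. \<forall>y\<in>?S. E x y \<longrightarrow> g x \<noteq> g y"
        by (rule bip_ex)
      then obtain g :: "'a \<Rightarrow> bool" where g: "\<And>x y. x \<in> ?S \<Longrightarrow> y \<in> ?S \<Longrightarrow> E x y \<Longrightarrow> g x \<noteq> g y" by blast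
      have "g x = g y" using g[of w x] g[of w t] g[of w' t] g[of w' y] M(1)[OF w(1)] M(1)[OF w(2)]
        xy by auto
      moreover have "g x \<noteq> g y" using agree[of g] g xy hxy by auto
      ultimately show False by simp
    qed
  qed
  \<comment> \<open>All mixed vertices attach to one side of \<open>h\<close>, so one of
    \<open>r\<close> and \<open>z\<close> is seen by none of them.\<close>
  obtain x' where x': "x' \<in> X" "\<And>w. M w \<Longrightarrow> \<not> E w x'"
  proof -
    have "(\<forall>w. M w \<longrightarrow> \<not> E w r) \<or> (\<forall>w. M w \<longrightarrow> \<not> E w z)"
      using same[of _ _ r z] X(3-5) h[of r z] by blast
    then show ?thesis using that X(3,4) by blast
  qed
  define A where "A = {x \<in> X. E x' x}"
  define B where "B = {x. x \<notin> X \<and> E x' x}"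
  have Bx: "E b x" if "b \<in> B" "x \<in> X" for b x
    using that x'(2)[of b] x'(1) sym unfolding B_def M_def by blast
  show False
  proof (rule nbh_not_complete_bipartite[of x' A B])
    show "x' \<in> U" using x' X(2) by blast
    show "E x' x" if "x \<in> A" for x using that A_def by blast
    show "E x' x" if "x \<in> B" for x using that B_def by blast
    show "E x y" if "x \<in> A" "y \<in> B" for x y using that Bx[of y x] sym unfolding A_def by blast
  next
    fix x y assume xy: "E x' x" "E x' y" "E x y"
    have "\<not> (x \<in> A \<and> y \<in> A)" using tri[of x' x y] xy x'(1) A_def sym by blast
    moreover have "\<not> (x \<in> B \<and> y \<in> B)"
      using K4[of r z x y] Bx[of x r] Bx[of x z] Bx[of y r] Bx[of y z] X(3-5) xy(3) sym by blast
    ultimately show "(x \<in> A \<and> y \<in> B) \<or> (x \<in> B \<and> y \<in> A)" using xy A_def B_def by blast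
  qed
qed

text \<open>\<open>r\<close> and \<open>z\<close> lie in one component \<open>X\<close> of the
  vertices that see \<open>q\<close> and \<open>s\<close> but not \<open>p\<close> and
  \<open>t\<close>. Bulls force a vertex that distinguishes the ends of an edge of \<open>X\<close>
  to see \<open>t\<close> and miss \<open>s\<close>, as \<open>no_clone_component\<close>
  requires.\<close>

lemma P5_middle:
  assumes P: "E p q" "E q r" "E r s" "E s t" "\<not> E p r" "\<not> E p s" "\<not> E p t" "\<not> E q s" "\<not> E q t"
    "\<not> E r t"
    and z: "E z q" "E z r" "E z s" "\<not> E z p" "\<not> E z t"
  shows False
proof -
  define S where "S = {x \<in> U. E x q \<and> E x s \<and> \<not> E x p \<and> \<not> E x t}"
  have "r \<in> S" using P E_in sym unfolding S_def by blast
  then obtain X where X: "X \<subseteq> S" "r \<in> X" "conn E X" "\<And>x y. x \<in> X \<Longrightarrow> y \<in> S \<Longrightarrow> E x y \<Longrightarrow> y \<in> X"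
    using component[of E r S] sym by blast
  have XS: "x \<in> U" "E x q" "E x s" "E q x" "E s x" "\<not> E x p" "\<not> E x t" "\<not> E p x" "\<not> E t x" if
    "x \<in> X" for x
    using that X(1) sym unfolding S_def by blast+
  have "z \<in> S" using z E_in unfolding S_def by blast
  then have zX: "z \<in> X" using X(4)[OF X(2)] z sym by blast
  show False
  proof (rule no_clone_component[of X r z s t])
    fix w x y
    assume w: "w \<notin> X" "x \<in> X" "y \<in> X" "E x y" "E w x" "\<not> E w y"
    have wS: "w \<notin> S" using X(4)[of x w] w sym by blast
    \<comment> \<open>Used with \<open>(c, c')\<close> as \<open>(s, t)\<close> and as
      \<open>(q, p)\<close>: three bulls show that \<open>w\<close> cannot see just one of
      \<open>q\<close> and \<open>s\<close>.\<close>
    have one: False if "E w c" "\<not> E w a" and c: "E c c'" "E a a'" "\<not> E c a" "\<not> E c a'" "\<not> E a c'"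
      "\<not> E a' c'"
      and m: "E x a" "E x c" "E y a" "E y c" "\<not> E x a'" "\<not> E x c'" "\<not> E y a'" "\<not> E y c'" for a a' c
        c'
    proof -
      have "E w a'" using bull[of x a y w a'] w that sym by blast
      moreover have "E w c'" using bull[of w c x a' c'] w that calculation sym by blast
      ultimately show False using bull[of w c c' a' y] w that sym by blast
    qed
    have two: False if "E w c" "E w a" "E w c'" and c: "E c c'" "E a a'" "\<not> E c a" "\<not> E c a'"
      "\<not> E a c'" "\<not> E a' c'"
      and m: "E x a" "E x c" "E y a" "E y c" "\<not> E x a'" "\<not> E x c'" "\<not> E y a'" "\<not> E y c'" for a a' c
        c'
    proof -
      have "\<not> E w a'" using bull[of w c c' a' y] w that sym by blast
      then show False using bull[of w a x c' a'] w that sym by blast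
    qed
    note Xs = XS[OF w(2)] XS[OF w(3)]
    have "E w q \<longleftrightarrow> E w s"
      using one[of s q t p] one[of q s p t] Xs P sym by blast
    moreover have "\<not> (E w q \<and> E w s)"
    proof
      assume "E w q \<and> E w s"
      then have "E w p \<or> E w t" using wS w E_in unfolding S_def by blast
      then show False using two[of s q t p] two[of q s p t] \<open>E w q \<and> E w s\<close> Xs P sym by blast
    qed
    ultimately have "\<not> E w s" by blast
    moreover have "E w t" using bull[of x s y w t] w Xs P \<open>\<not> E w s\<close> sym by blast
    ultimately show "E w t \<and> \<not> E w s" by blast
  qed (use X zX z P XS sym in blast)+
qed

text \<open>Otherwise bulls make \<open>z\<close> see \<open>d\<close> and miss \<open>e\<close>,
  against \<open>P5_middle\<close>. The final argument transfers adjacencies along induced paths in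
  this way.\<close>

lemma P5_extend:
  assumes P: "E a b" "E b c" "E c d" "E d e" "\<not> E a c" "\<not> E a d" "\<not> E a e" "\<not> E b d" "\<not> E b e"
    "\<not> E c e"
    and z: "E z b" "E z c"
  shows "E z a"
proof (rule ccontr)
  assume za: "\<not> E z a"
  have "E z d" using bull[of b c z a d] P z za sym by blast
  moreover have "\<not> E z e" using bull[of b z c a e] P z za sym by blast
  ultimately show False using P5_middle[OF P] z za by blast
qed

text \<open>If \<open>R\<close> is disconnected, or if \<open>y\<close> has no neighbour in it,
  there is a star cutset centred at \<open>v\<close>; in the second case it separates
  \<open>y\<close> from \<open>R\<close>. If \<open>R\<close> is empty, \<open>{v}\<close> meets all
  triangles, since a triangle among the neighbours of \<open>v\<close> gives a
  \<open>K4\<close>.\<close>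

lemma nonneighbours_connected:
  assumes "v \<in> U"
  defines "R \<equiv> {x \<in> U. x \<noteq> v \<and> \<not> E v x}"
  shows "R \<noteq> {}" "conn E R" "E v y \<Longrightarrow> \<exists>r\<in>R. E y r"
proof -
  show ne: "R \<noteq> {}"
  proof
    assume "R = {}"
    then have N: "E v x" if "x \<in> U" "x \<noteq> v" for x using that unfolding R_def by blast
    show False
    proof (rule independent_transversal[of "{v}"])
      fix x y z assume t: "E x y" "E y z" "E x z"
      show "x \<in> {v} \<or> y \<in> {v} \<or> z \<in> {v}"
        using K4[of v x y z] N[of x] N[of y] N[of z] t E_in E_in' sym by blast
    qed (use irrefl in auto)
  qed
  have "v \<notin> R" by (simp add: R_def)
  have RU: "R \<subseteq> U" by (auto simp: R_def)
  show "conn E R" unfolding conn_def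
  proof (intro allI impI, rule ccontr)
    fix Y assume Y: "Y \<subseteq> R" "Y \<noteq> {}" "Y \<noteq> R" "\<not> (\<exists>y\<in>Y. \<exists>x\<in>R - Y. E y x)"
    show False
    proof (rule no_star_cutset[OF assms(1), of Y "R - Y"])
      show "x = v \<or> E v x" if "x \<in> U" "x \<notin> Y" "x \<notin> R - Y" for x
        using that unfolding R_def by blast
      show "\<not> E x y" if "x \<in> Y" "y \<in> R - Y" for x y using Y(4) that by blast
    qed (use Y \<open>v \<notin> R\<close> RU in auto)
  qed
  show "\<exists>r\<in>R. E y r" if vy: "E v y"
  proof (rule ccontr)
    assume no: "\<not> ?thesis"
    show False
    proof (rule no_star_cutset[OF assms(1), of "{y}" R])
      show "v \<notin> {y}" using vy irrefl by auto
      show "{y} \<subseteq> U" using vy E_in' by blast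
      show "{y} \<inter> R = {}" using vy by (auto simp: R_def)
      show "x = v \<or> E v x" if "x \<in> U" "x \<notin> {y}" "x \<notin> R" for x
        using that unfolding R_def by blast
    qed (use ne \<open>v \<notin> R\<close> RU no in auto)
  qed
qed

section \<open>The neighbourhood of a single vertex and the final contradiction\<close>

lemma no_critical_bip: False
proof -
  have "U \<noteq> {}" using noncol by (auto simp: col_on_def)
  then obtain v where v: "v \<in> U" by blast
  define R where "R = {x \<in> U. x \<noteq> v \<and> \<not> E v x}"
  note R = nonneighbours_connected[OF v, folded R_def]
  have Rv: "\<not> E v r" "\<not> E r v" if "r \<in> R" for r using that sym unfolding R_def by blast+
  define N' where "N' = {x. E v x \<and> (\<exists>a. E v a \<and> E a x)}"
  have N': "E v x" "E x v" if "x \<in> N'" for x using that sym unfolding N'_def by blast+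
  have finN': "finite N'" using fin by (rule rev_finite_subset) (use E_in' N'_def in auto)
  obtain f :: "'a \<Rightarrow> nat" where f: "\<forall>x\<in>U - {v}. f x < 3"
    "\<forall>x\<in>U - {v}. \<forall>y\<in>U - {v}. E x y \<longrightarrow> f x \<noteq> f y"
    using col_minus[OF v] by blast
  \<comment> \<open>By \<open>Kempe\<close> some vertex of \<open>N'\<close> has the colour of
    \<open>d\<close>, and so is not adjacent to \<open>d\<close>.\<close>
  have miss: "\<exists>y\<in>N'. \<not> E d y" if d: "d \<in> R" for d
  proof -
    have dU: "d \<in> U - {v}" using d by (simp add: R_def)
    then have fd: "f d < 3" using f by blast
    define j where "j = (if f d = 0 then 1 else 0 :: nat)"
    obtain x y where xy: "E v x" "E v y" "E x y" "f x = f d" "f y = j"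
      by (rule Kempe[OF v f fd, of j]) (auto simp: j_def split: if_splits)
    have "x \<in> N'" using xy sym unfolding N'_def by blast
    moreover have "x \<in> U - {v}" using xy(1) E_in' irrefl by blast
    then have "\<not> E d x" using f(2) dU xy(4) by metis
    ultimately show ?thesis by blast
  qed
  define g where "g d = card {x \<in> N'. E d x}" for d
  have "finite R" using fin by (simp add: R_def)
  then have "Max (g ` R) \<in> g ` R" using R(1) by (intro Max_in) auto
  then obtain d where d: "d \<in> R" "g d = Max (g ` R)" by fastforce
  have max: "g e \<le> g d" if "e \<in> R" for e
    unfolding d(2) using \<open>finite R\<close> that by (intro Max_ge) auto
  obtain y0 where y0: "y0 \<in> N'" "\<not> E d y0" using miss[OF d(1)] by blast
  obtain x0 where x0: "x0 \<in> N'" "E d x0"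
  proof -
    obtain r where r: "r \<in> R" "E y0 r" using R(3)[of y0] N'[OF y0(1)] by blast
    have "{x \<in> N'. E r x} \<noteq> {}" using r y0 sym by blast
    then have "0 < g r" unfolding g_def using finN' by (simp add: card_gt_0_iff)
    then have "0 < g d" using max[OF r(1)] by simp
    then have "{x \<in> N'. E d x} \<noteq> {}" unfolding g_def by (metis card.empty less_irrefl)
    then show ?thesis using that by blast
  qed
  \<comment> \<open>Twins within the neighbourhood of \<open>v\<close>. The contradiction at the end
    is that \<open>x\<close> and \<open>y\<close> below are twins.\<close>
  define tw where "tw x y \<longleftrightarrow> (\<forall>a. E v a \<longrightarrow> (E a x \<longleftrightarrow> E a y))" for x y
  have N'I: "p \<in> N'" "q \<in> N'" if "E v p" "E v q" "E p q" for p q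
    using that sym unfolding N'_def by blast+
  \<comment> \<open>Otherwise the edges in the neighbourhood of \<open>v\<close> form a complete
    bipartite graph. If a nonadjacent pair \<open>x, y\<close> exists, one side consists of the
    neighbours of \<open>x\<close>; if none exists, of the neighbours of \<open>d\<close> in
    \<open>N'\<close>.\<close>
  obtain x y where x: "x \<in> N'" "E d x" and y: "y \<in> N'" "\<not> E d y" and xy: "\<not> E x y" and ntw:
    "\<not> tw x y"
  proof (rule ccontr)
    assume "\<not> thesis"
    then have all: "tw x y" if "x \<in> N'" "E d x" "y \<in> N'" "\<not> E d y" "\<not> E x y" for x y
      using that \<open>\<And>x y. \<lbrakk>x \<in> N'; E d x; y \<in> N'; \<not> E d y; \<not> E x y; \<not> tw x y\<rbrakk> \<Longrightarrow> thesis\<close> by blast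
    show False
    proof (cases "\<exists>x y. x \<in> N' \<and> E d x \<and> y \<in> N' \<and> \<not> E d y \<and> \<not> E x y")
      case True
      then obtain x y where x: "x \<in> N'" "E d x" and y: "y \<in> N'" "\<not> E d y" and xy: "\<not> E x y" by blast
      have txy: "tw x y" by (rule all[OF x y xy])
      define A where "A = {a. E v a \<and> E a x}"
      define B where "B = N' - A"
      have Btw: "tw u x" if u: "u \<in> B" for u
      proof -
        have u': "u \<in> N'" "E v u" "\<not> E u x" using u N' unfolding B_def A_def by blast+
        then have "\<not> E u y" using txy unfolding tw_def by blast
        show ?thesis
        proof (cases "E d u")
          case True
          then have "tw u y" using all[of u y] u' y \<open>\<not> E u y\<close> by blast
          then show ?thesis using txy unfolding tw_def by blast
        next
          case False
          then have "tw x u" using all[of x u] u' x sym by blast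
          then show ?thesis unfolding tw_def by blast
        qed
      qed
      show False
      proof (rule nbh_not_complete_bipartite[OF v, of A B])
        show "E v p" if "p \<in> A" for p using that A_def by blast
        show "E v p" if "p \<in> B" for p using that B_def N' by blast
        show "E p q" if "p \<in> A" "q \<in> B" for p q
          using that Btw[of q] unfolding tw_def A_def by blast
      next
        fix p q assume pq: "E v p" "E v q" "E p q"
        have "\<not> (p \<in> A \<and> q \<in> A)" using K4[of v p q x] pq N'[OF x(1)] unfolding A_def by blast
        moreover have "\<not> (p \<in> B \<and> q \<in> B)"
          using Btw[of q] pq unfolding tw_def B_def A_def by blast
        ultimately show "p \<in> A \<and> q \<in> B \<or> p \<in> B \<and> q \<in> A" using N'I[OF pq] B_def by blast
      qed
    next
      case False
      define A where "A = {x \<in> N'. E d x}"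
      define B where "B = N' - A"
      have AB: "E p q" if "p \<in> A" "q \<in> B" for p q using that False unfolding A_def B_def by blast
      have y0B: "y0 \<in> B" and x0A: "x0 \<in> A" using y0 x0 unfolding A_def B_def by blast+
      show False
      proof (rule nbh_not_complete_bipartite[OF v, of A B])
        show "E v p" if "p \<in> A" for p using that A_def N' by blast
        show "E v p" if "p \<in> B" for p using that B_def N' by blast
      next
        fix p q assume pq: "E v p" "E v q" "E p q"
        have "\<not> (p \<in> A \<and> q \<in> A)" using K4[of v p q y0] pq AB[OF _ y0B] N'[OF y0(1)] by blast
        moreover have "\<not> (p \<in> B \<and> q \<in> B)"
          using K4[of v p q x0] pq AB[OF x0A] N'[OF x0(1)] sym by blast
        ultimately show "p \<in> A \<and> q \<in> B \<or> p \<in> B \<and> q \<in> A" using N'I[OF pq] B_def by blast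
      qed (rule AB)
    qed
  qed
  \<comment> \<open>The competitor \<open>b\<close> of \<open>d\<close> is found among the vertices
    of \<open>R\<close> that see \<open>y\<close>: it has a neighbour \<open>s\<close> in the
    component \<open>D\<close> of \<open>d\<close> in the rest of \<open>R\<close>.\<close>
  define B where "B = {r \<in> R. E y r}"
  have dB: "d \<in> R - B" using d y sym unfolding B_def by blast
  obtain D where D: "D \<subseteq> R - B" "d \<in> D" "conn E D" "\<And>p q. p \<in> D \<Longrightarrow> q \<in> R - B \<Longrightarrow> E p q \<Longrightarrow> q \<in> D"
    using component[OF _ dB, of E] sym by blast
  have DR: "r \<in> R" "\<not> E v r" "\<not> E r v" "\<not> E y r" "\<not> E r y" if "r \<in> D" for r
    using that D(1) Rv sym unfolding B_def by blast+
  obtain r0 where "r0 \<in> R" "E y r0" using R(3)[of y] N'[OF y(1)] by blast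
  then have r0: "r0 \<in> R" "r0 \<notin> D" using DR(4) by blast+
  obtain s b where s: "s \<in> D" "E s b" "b \<in> R" "b \<notin> D"
    using conn_crossing[of E R d "\<lambda>r. r \<in> D" r0] R(2) d(1) D(2) r0 by blast
  have bB: "b \<in> B" using D(4)[of s b] s by blast
  have b: "E y b" "E b y" "\<not> E v b" "\<not> E b v" "E b s" using bB Rv s sym unfolding B_def by blast+
  note vy = N'[OF y(1)] and vx = N'[OF x(1)]
  \<comment> \<open>No vertex of \<open>D\<close> sees both \<open>z\<close> and \<open>b\<close>,
    by \<open>C5\<close>, so along some edge \<open>e r\<close> of \<open>D\<close> adjacency to
    \<open>z\<close> ends. \<open>P5_extend\<close> on the induced paths
    \<open>y, v, z, e, r\<close> and \<open>z, v, y, b, s\<close> carries adjacency over in both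
    directions.\<close>
  have claim1: "tw z y" if z: "E v z" "E d z" "\<not> E z y" "\<not> E z b" for z
  proof -
    have no: "\<not> (E r z \<and> E b r)" if "r \<in> D" for r
      using C5[of v z r b y] z vy b DR[OF that] sym by blast
    have "\<not> E s z" using no[OF s(1)] b by blast
    obtain e r where er: "e \<in> D" "r \<in> D" "E e r" "E e z" "\<not> E r z"
      using conn_crossing[of E D d "\<lambda>r. E r z" s] D(2,3) s(1) z(2) \<open>\<not> E s z\<close> by blast
    have 1: "E a y" if "E v a" "E a z" for a
      using P5_extend[of y v z e r a] that vy z er DR[OF er(1)] DR[OF er(2)] sym by blast
    have 2: "E a z" if "E v a" "E a y" for a
      using P5_extend[of z v y b s a] that vy z b DR[OF s(1)] \<open>\<not> E s z\<close> sym by blast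
    show ?thesis unfolding tw_def using 1 2 by blast
  qed
  have xb: "E x b" "E b x" using claim1[of x] vx x xy ntw sym by blast+
  \<comment> \<open>Here the choice of \<open>d\<close> enters: \<open>b\<close> sees
    \<open>y\<close>, which \<open>d\<close> misses, so by maximality \<open>b\<close> misses some
    neighbour of \<open>d\<close> in \<open>N'\<close>.\<close>
  obtain z where z: "z \<in> N'" "E d z" "\<not> E b z"
  proof (rule ccontr)
    assume "\<not> thesis"
    then have "{x \<in> N'. E d x} \<subset> {x \<in> N'. E b x}" using that y b by blast
    then have "g d < g b" unfolding g_def using finN' by (intro psubset_card_mono) auto
    then show False using max[OF s(3)] by simp
  qed
  note vz = N'[OF z(1)]
  have zb: "\<not> E z b" "E z d" "E x d" "\<not> E y x" using z x xy sym by blast+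
  \<comment> \<open>Otherwise \<open>z\<close> is a twin of \<open>y\<close>, and some
    \<open>c\<close> sees \<open>x\<close> but neither of them. Whether \<open>s\<close> sees
    \<open>x\<close> or not, \<open>P5_extend\<close> or a bull gives a contradiction.\<close>
  have zy: "E z y"
  proof (rule ccontr)
    assume zy: "\<not> E z y"
    have t: "tw z y" using claim1[of z] vz z zy zb by blast
    then have zx: "\<not> E z x" "\<not> E x z" using vx zb xy sym unfolding tw_def by blast+
    have db: "\<not> E d b" using C5[of v z d b y] z vz vy b zy zb DR[OF D(2)] sym by blast
    have sz: "\<not> E s z"
      using C5[of v z s b y] vz vy b zy zb DR[OF s(1)] sym by blast
    have "E a x" if a: "E v a" "E a y" for a
    proof -
      have az: "E a z" using t a unfolding tw_def by blast
      have "E a b" using P5_extend[of b y v z d a] a b vy vz z zb zy db DR[OF D(2)] sym by blast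
      then show ?thesis using bull[of a b y z x] a az b zy z xb zb zx xy sym by blast
    qed
    then obtain c where c: "E v c" "E c x" "\<not> E c y" using ntw unfolding tw_def by blast
    then have cz: "\<not> E c z" using t unfolding tw_def by blast
    show False
    proof (cases "E x s")
      case False
      then show False using P5_extend[of z v x b s c] c cz vz vx xb b zx z sz zb DR[OF s(1)] sym by
        blast
    next
      case True
      show False
      proof (cases "E d s")
        case True
        then show False using P5_extend[of y b s d z x] \<open>E x s\<close> xb b s z zb db sz zy xy DR[OF s(1)]
          DR[OF D(2)] sym by blast
      next
        case False
        then show False using bull[of b x s y d] \<open>E x s\<close> xb b s x db zb DR[OF s(1)] DR[OF D(2)] sym
          by blast
      qed
    qed
  qed
  have yz: "E y z" using zy sym by blast
  note E1 = vx vy vz xb b zb yz zy x(2) z(2,3) y(2) xy DR[OF D(2)]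
  have no_pr: False if "E v u" "E d u" "E b u" "\<not> E u z" "\<not> E u y" "E d b" for u
  proof -
    have "prism v y z u b d" unfolding prism_def using that E1 sym by blast
    then show False using no_prism by blast
  qed
  \<comment> \<open>Otherwise \<open>d, x, b, y, z\<close> is a 5-cycle whose only possible chord
    joins \<open>d\<close> and \<open>b\<close>, and \<open>x\<close> completes a prism.\<close>
  have xz: "E x z"
  proof (rule ccontr)
    assume xz: "\<not> E x z"
    then have "E d b" using C5[of d x b y z] E1 sym by blast
    then show False using no_pr[of x] E1 xz by blast
  qed
  have db: "E d b" using bull[of z y v d b] E1 sym by blast
  \<comment> \<open>Bulls on the triangle \<open>v, y, z\<close> would join \<open>u\<close> to
    \<open>d\<close> and \<open>b\<close>, completing the prism of \<open>no_pr\<close>.\<close>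
  have dom: "E u z \<or> E u y" if u: "E v u" for u
  proof (rule ccontr)
    assume n: "\<not> ?thesis"
    have "E u d" using bull[of v z y u d] u n E1 sym by blast
    moreover have "E u b" using bull[of v y z u b] u n E1 sym by blast
    ultimately show False using no_pr[of u] u n db sym by blast
  qed
  \<comment> \<open>Otherwise the diamonds \<open>z, x, d, b\<close> and \<open>b, w, y, v\<close>,
    closed by the edge from \<open>v\<close> to \<open>z\<close>, form a Moser spindle.\<close>
  have "E w x" if w: "E v w" "E w y" for w
  proof (rule ccontr)
    assume wx: "\<not> E w x"
    have wz: "\<not> E w z" using K4[of v y z w] w E1 sym by blast
    have wb: "E w b" using bull[of v x z w b] w wx wz xz E1 sym by blast
    have "z \<noteq> d" "x \<noteq> d" "v \<noteq> d" "y \<noteq> d" "w \<noteq> d" "b \<noteq> d" using E1 w db irrefl wz by metis+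
    moreover have "z \<noteq> x" "z \<noteq> b" "z \<noteq> w" "z \<noteq> y" "z \<noteq> v" "x \<noteq> b" "x \<noteq> w" "x \<noteq> y" "x \<noteq> v"
      "b \<noteq> w" "b \<noteq> y" "b \<noteq> v" "w \<noteq> y" "w \<noteq> v" "y \<noteq> v" using E1 w wx wz wb xz irrefl by metis+
    ultimately have "distinct [z, x, d, b, w, y, v]" by auto
    then show False using Moser[of z x d b w y v] E1 w wb xz db sym by blast
  qed
  moreover have "E w y" if w: "E v w" "E w x" for w
    using dom[OF w(1)] K4[of v x z w] w xz E1 sym by blast
  ultimately show False using ntw unfolding tw_def by blast
qed

end

subsection \<open>Embeddings of the forbidden graphs\<close>

lemma wf_ugraph: "E \<subseteq> V \<times> V \<Longrightarrow> pair_wf_digraph (ugraph V E)"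
  by (auto simp: pair_wf_digraph_def ugraph_def)

lemma contains_inducedI:
  assumes "pair_graph G" "E \<subseteq> V \<times> V" "inj_on f V" "f ` V \<subseteq> pverts G"
    "\<And>u v. u \<in> V \<Longrightarrow> v \<in> V \<Longrightarrow> (u, v) \<in> E \<or> (v, u) \<in> E \<longleftrightarrow> (f u, f v) \<in> parcs G"
  shows "contains_induced G (ugraph V E)"
proof -
  interpret pair_graph G by fact
  show ?thesis
    unfolding contains_induced_iff_embedding[OF pair_wf_digraph_axioms wf_ugraph[OF assms(2)]]
    using assms(3-5) by (intro exI[of _ f]) (auto simp: ugraph_def)
qed

lemma S_graph_123: "S_graph 1 2 3 = ugraph {(0, 0), (1, 1), (2, 1), (2, 2), (3, 1), (3, 2), (3, 3)}
    {((0, 0), (1, 1)), ((0, 0), (2, 1)), ((0, 0), (3, 1)), ((2, 1), (2, 2)), ((3, 1), (3, 2)), ((3, 2), (3, 3))}"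
proof -
  define L :: "(nat \<times> nat) set" where "L = {(1, 1), (2, 1), (2, 2), (3, 1), (3, 2), (3, 3)}"
  have m: "1 \<le> m \<and> m \<le> 1 \<longleftrightarrow> m = 1" "1 \<le> m \<and> m \<le> 2 \<longleftrightarrow> m = 1 \<or> m = 2"
    "1 \<le> m \<and> m \<le> 3 \<longleftrightarrow> m = 1 \<or> m = 2 \<or> m = 3" for m :: nat
    by presburger+
  have "{(a, m). a = 1 \<and> 1 \<le> m \<and> m \<le> 1 \<or> a = 2 \<and> 1 \<le> m \<and> m \<le> 2 \<or> a = 3 \<and> 1 \<le> m \<and> m \<le> 3} = L"
    unfolding m L_def by blast
  moreover have
    "{((0, 0), (a, 1 :: nat)) | a. (a, 1) \<in> L} = {((0, 0), (1, 1)), ((0, 0), (2, 1)), ((0 :: nat, 0 :: nat), (3, 1))}"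
    unfolding L_def by auto
  moreover have "{((a, m), (a, m + 1)) | a m. (a, m) \<in> L \<and> (a, m + 1) \<in> L} =
      {((2, 1), (2, 2)), ((3, 1), (3, 2)), ((3, 2), (3, 3))}" (is "?l = ?r")
  proof
    have "m + 1 = 2 \<longleftrightarrow> m = 1" "m + 1 = 3 \<longleftrightarrow> m = 2" "m + 1 = 1 \<longleftrightarrow> m = 0" for m :: nat by auto
    then show "?l \<subseteq> ?r" unfolding L_def by auto
    have "((2, 1), (2, 1 + 1)) \<in> ?l" "((3, 1), (3, 1 + 1)) \<in> ?l" "((3, 2), (3, 2 + 1)) \<in> ?l"
      unfolding L_def by force+
    then show "?r \<subseteq> ?l" by simp
  qed
  ultimately have "S_graph 1 2 3 = ugraph (insert (0, 0) L) ({((0, 0), (1, 1)), ((0, 0), (2, 1)), ((0, 0), (3, 1))} \<union>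
      {((2, 1), (2, 2)), ((3, 1), (3, 2)), ((3, 2), (3, 3))})"
    unfolding S_graph_def Let_def by (simp only:)
  then show ?thesis unfolding L_def by (simp only: Un_insert_left Un_empty_left)
qed

lemma S_graph_113: "S_graph 1 1 3 = ugraph {(0, 0), (1, 1), (2, 1), (3, 1), (3, 2), (3, 3)}
    {((0, 0), (1, 1)), ((0, 0), (2, 1)), ((0, 0), (3, 1)), ((3, 1), (3, 2)), ((3, 2), (3, 3))}"
proof -
  define L :: "(nat \<times> nat) set" where "L = {(1, 1), (2, 1), (3, 1), (3, 2), (3, 3)}"
  have m: "1 \<le> m \<and> m \<le> 1 \<longleftrightarrow> m = 1" "1 \<le> m \<and> m \<le> 2 \<longleftrightarrow> m = 1 \<or> m = 2"
    "1 \<le> m \<and> m \<le> 3 \<longleftrightarrow> m = 1 \<or> m = 2 \<or> m = 3" for m :: nat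
    by presburger+
  have "{(a, m). a = 1 \<and> 1 \<le> m \<and> m \<le> 1 \<or> a = 2 \<and> 1 \<le> m \<and> m \<le> 1 \<or> a = 3 \<and> 1 \<le> m \<and> m \<le> 3} = L"
    unfolding m L_def by blast
  moreover have
    "{((0, 0), (a, 1 :: nat)) | a. (a, 1) \<in> L} = {((0, 0), (1, 1)), ((0, 0), (2, 1)), ((0 :: nat, 0 :: nat), (3, 1))}"
    unfolding L_def by auto
  moreover have "{((a, m), (a, m + 1)) | a m. (a, m) \<in> L \<and> (a, m + 1) \<in> L} =
      {((3, 1), (3, 2)), ((3, 2), (3, 3))}" (is "?l = ?r")
  proof
    have "m + 1 = 2 \<longleftrightarrow> m = 1" "m + 1 = 3 \<longleftrightarrow> m = 2" "m + 1 = 1 \<longleftrightarrow> m = 0" for m :: nat by auto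
    then show "?l \<subseteq> ?r" unfolding L_def by auto
    have "((3, 1), (3, 1 + 1)) \<in> ?l" "((3, 2), (3, 2 + 1)) \<in> ?l"
      unfolding L_def by force+
    then show "?r \<subseteq> ?l" by simp
  qed
  ultimately have "S_graph 1 1 3 = ugraph (insert (0, 0) L) ({((0, 0), (1, 1)), ((0, 0), (2, 1)), ((0, 0), (3, 1))} \<union>
      {((3, 1), (3, 2)), ((3, 2), (3, 3))})"
    unfolding S_graph_def Let_def by (simp only:)
  then show ?thesis unfolding L_def by (simp only: Un_insert_left Un_empty_left)
qed

text \<open>The subgraph \<open>M\<close> keeps only the prescribed edges, because the neighbourhood
  conditions of a spindle are equalities; further edges of \<open>G\<close> on these vertices are
  dropped.\<close>

lemma contains_spindleI:
  fixes u :: "nat \<Rightarrow> 'a"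
  assumes G: "pair_graph G" and p: "1 \<le> p" and inj: "inj_on u {..3 * p}"
    and chain: "\<And>k. k < p \<Longrightarrow> {(u (3 * k), u (3 * k + 1)), (u (3 * k), u (3 * k + 2)),
      (u (3 * k + 1), u (3 * k + 2)), (u (3 * k + 1), u (3 * k + 3)), (u (3 * k + 2), u (3 * k +
        3))}
      \<subseteq> parcs G"
    and close: "(u (3 * p), u 0) \<in> parcs G"
  shows "contains_spindle G"
proof -
  interpret G: pair_graph G by (rule G)
  \<comment> \<open>The diamonds are \<open>3k, 3k + 1, 3k + 2, 3k + 3\<close>. A step of 2 from an
    index congruent to 2 modulo 3 would lead into the next diamond.\<close>
  define adj where
    "adj a b \<longleftrightarrow> (a < 3 * p \<and> (b = a + 1 \<or> b = a + 2 \<and> a mod 3 \<noteq> 2)) \<or> (a = 3 * p \<and> b = 0)"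
    for a b :: nat
  define M where "M = ugraph (u ` {..3 * p}) {(u a, u b) | a b. adj a b}"
  have bd: "a \<le> 3 * p" "b \<le> 3 * p" "a \<noteq> b" if "adj a b" for a b
    using that p unfolding adj_def by presburger+
  have inG: "(u a, u b) \<in> parcs G" if "adj a b" for a b
  proof (cases "a < 3 * p")
    case True
    define k where "k = a div 3"
    have "k < p" using True by (simp add: k_def less_mult_imp_div_less)
    have "a = 3 * k \<or> a = 3 * k + 1 \<or> a = 3 * k + 2" unfolding k_def by presburger
    then consider "a = 3 * k" | "a = 3 * k + 1" | "a = 3 * k + 2" by blast
    then show ?thesis
    proof cases
      case 1
      then have "b = 3 * k + 1 \<or> b = 3 * k + 2" using that True by (auto simp: adj_def)
      then show ?thesis using chain[OF \<open>k < p\<close>] unfolding 1 by blast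
    next
      case 2
      then have "b = 3 * k + 2 \<or> b = 3 * k + 3" using that True by (auto simp: adj_def)
      then show ?thesis using chain[OF \<open>k < p\<close>] unfolding 2 by blast
    next
      case 3
      then have "a mod 3 = 2" by presburger
      then have "b = 3 * k + 3" using that True 3 by (simp add: adj_def)
      then show ?thesis using chain[OF \<open>k < p\<close>] unfolding 3 by blast
    qed
  next
    case False
    then show ?thesis using that close by (auto simp: adj_def)
  qed
  have ueq: "u a = u b \<longleftrightarrow> a = b" if "a \<le> 3 * p" "b \<le> 3 * p" for a b
    using inj_on_eq_iff[OF inj] that by simp
  have arcsM: "e \<in> parcs M \<longleftrightarrow> (\<exists>a b. e = (u a, u b) \<and> (adj a b \<or> adj b a))" for e
    unfolding M_def ugraph_def by (cases e) auto
  have vertsM: "pverts M = u ` {..3 * p}" by (simp add: M_def ugraph_def)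
  have parcsM: "(u a, w) \<in> parcs M \<longleftrightarrow> (\<exists>b. w = u b \<and> (adj a b \<or> adj b a))" if "a \<le> 3 * p" for a w
    unfolding arcsM using ueq[OF that] bd by (metis prod.inject)
  have nb: "nbrs M (u a) = u ` {b. adj a b \<or> adj b a}" if "a \<le> 3 * p" for a
    unfolding nbrs_def parcsM[OF that] by blast
  have pgM: "pair_graph M"
  proof unfold_locales
    show "fst e \<in> pverts M" "snd e \<in> pverts M" "fst e \<noteq> snd e" if e: "e \<in> parcs M" for e
    proof -
      obtain a b where "e = (u a, u b)" "adj a b \<or> adj b a" using e arcsM by blast
      moreover from this have "a \<le> 3 * p" "b \<le> 3 * p" "a \<noteq> b" using bd by blast+
      ultimately show "fst e \<in> pverts M" "snd e \<in> pverts M" "fst e \<noteq> snd e"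
        using ueq by (simp_all add: vertsM)
    qed
    then have "parcs M \<subseteq> pverts M \<times> pverts M" by (auto simp: mem_Times_iff)
    then show "finite (parcs M)" by (rule finite_subset) (simp add: vertsM)
    show "finite (pverts M)" by (simp add: vertsM)
    show "symmetric (with_proj M)" by (auto simp: symmetric_def sym_def arcsM)
  qed
  have cardM: "card (pverts M) = 3 * p + 1"
    using card_image[OF inj] by (simp add: M_def ugraph_def)
  have cyc: "(u i, u ((i + 1) mod (3 * p + 1))) \<in> parcs M" if "i \<le> 3 * p" for i
  proof (cases "i = 3 * p")
    case True
    then show ?thesis using parcsM[OF that] by (auto simp: adj_def)
  next
    case False
    then have i: "(i + 1) mod (3 * p + 1) = i + 1" using that by simp
    have "adj i (i + 1)" using False that by (simp add: adj_def)
    then show ?thesis using parcsM[OF that] i by auto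
  qed
  have nbM: "nbrs M (u (3 * i)) = {u (3 * i - 2), u (3 * i - 1), u ((3 * i + 1) mod (3 * p + 1))} \<union>
           (if i < p then {u (3 * i + 2)} else {})"
     "nbrs M (u (3 * i - 1)) \<inter> nbrs M (u (3 * i - 2)) = {u (3 * i - 3), u (3 * i)}"
     if i: "i \<in> {1..p}" for i
  proof -
    obtain k where k: "i = Suc k" "k < p" using i by (cases i) auto
    have sh: "3 * i = 3 * k + 3" "3 * i - 2 = 3 * k + 1" "3 * i - 1 = 3 * k + 2"
      "3 * i - 3 = 3 * k" using k by auto
    have md: "(3 * k + 3) mod 3 = 0" "(3 * k + 2) mod 3 = 2" "(3 * k + 1) mod 3 = 1"
      "3 * k mod 3 = 0"
      by presburger+
    have out: "adj (3 * k) b \<longleftrightarrow> b = 3 * k + 1 \<or> b = 3 * k + 2"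
      "adj (3 * k + 1) b \<longleftrightarrow> b = 3 * k + 2 \<or> b = 3 * k + 3"
      "adj (3 * k + 2) b \<longleftrightarrow> b = 3 * k + 3"
      "adj (3 * k + 3) b \<longleftrightarrow> (if i < p then b = 3 * k + 4 \<or> b = 3 * k + 5 else b = 0)" for b
      unfolding adj_def md using k by auto
    have ge: "3 * k \<le> b" if "adj b d" "d \<in> {3 * k + 1, 3 * k + 2, 3 * k + 3}" for b d
    proof (rule ccontr)
      assume "\<not> 3 * k \<le> b"
      then have "b + 1 = 3 * k" "b mod 3 \<noteq> 2" using that k(2) by (auto simp: adj_def)
      then show False by presburger
    qed
    have "b = 3 * k \<or> b = 3 * k + 1 \<or> b = 3 * k + 2" if "adj b d"
      "d \<in> {3 * k + 1, 3 * k + 2, 3 * k + 3}" for b d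
      using ge[OF that] that by (auto simp: adj_def)
    then have inn: "adj b d \<longleftrightarrow> (b = 3 * k \<or> b = 3 * k + 1 \<or> b = 3 * k + 2) \<and> adj b d"
      if "d \<in> {3 * k + 1, 3 * k + 2, 3 * k + 3}" for b d
      using that by blast
    have "adj (3 * k + 3) b \<or> adj b (3 * k + 3) \<longleftrightarrow> b = 3 * k + 1 \<or> b = 3 * k + 2 \<or>
        (if i < p then b = 3 * k + 4 \<or> b = 3 * k + 5 else b = 0)" for b
      using inn[of "3 * k + 3" b] out by auto
    moreover have "(3 * k + 3 + 1) mod (3 * p + 1) = (if i < p then 3 * k + 4 else 0)"
    proof (cases "i < p")
      case False
      then have "p = Suc k" using k by simp
      then show ?thesis using False by simp
    qed (use k in simp)
    ultimately have 0: "{b. adj (3 * k + 3) b \<or> adj b (3 * k + 3)} =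
        {3 * k + 1, 3 * k + 2, (3 * k + 3 + 1) mod (3 * p + 1)} \<union> (if i < p then {3 * k + 5} else {})"
      by auto
    have "adj (3 * k + 1) b \<or> adj b (3 * k + 1) \<longleftrightarrow> b = 3 * k \<or> b = 3 * k + 2 \<or> b = 3 * k + 3"
      "adj (3 * k + 2) b \<or> adj b (3 * k + 2) \<longleftrightarrow> b = 3 * k \<or> b = 3 * k + 1 \<or> b = 3 * k + 3" for b
      using inn[of "3 * k + 1" b] inn[of "3 * k + 2" b] out by auto
    then have 1: "{b. adj (3 * k + 1) b \<or> adj b (3 * k + 1)} = {3 * k, 3 * k + 2, 3 * k + 3}"
      and 2: "{b. adj (3 * k + 2) b \<or> adj b (3 * k + 2)} = {3 * k, 3 * k + 1, 3 * k + 3}" by auto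
    have le: "3 * k + 3 \<le> 3 * p" "3 * k + 1 \<le> 3 * p" "3 * k + 2 \<le> 3 * p" "3 * k \<le> 3 * p" using k by
      auto
    show "nbrs M (u (3 * i)) = {u (3 * i - 2), u (3 * i - 1), u ((3 * i + 1) mod (3 * p + 1))} \<union>
           (if i < p then {u (3 * i + 2)} else {})"
      unfolding sh(2-4) unfolding sh(1) nb[OF le(1)] 0 by (auto simp: add.commute)
    show "nbrs M (u (3 * i - 1)) \<inter> nbrs M (u (3 * i - 2)) = {u (3 * i - 3), u (3 * i)}"
      unfolding sh(2-4) unfolding sh(1) nb[OF le(2)] nb[OF le(3)] 1 2 using ueq[OF le(2,3)] by auto
  qed
  have "spindle p M" unfolding spindle_def
  proof (intro conjI exI[of _ u] allI impI ballI)
    show "u ` {..3 * p} \<subseteq> pverts M" by (simp add: vertsM)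
  qed (fact p pgM cardM inj | rule cyc nbM; assumption)+
  moreover have "subgraph (with_proj M) (with_proj G)"
  proof -
    have MG: "parcs M \<subseteq> parcs G" using inG G.arcs_symmetric arcsM by auto
    moreover have "pverts M \<subseteq> pverts G"
      using MG cyc G.in_arcsD1 unfolding vertsM by blast
    moreover have "wf_digraph (with_proj M)"
    proof -
      interpret M: pair_graph M by (rule pgM)
      show ?thesis by (rule M.wf_digraph)
    qed
    ultimately show ?thesis using G.wf_digraph by (auto simp: subgraph_def compatible_def)
  qed
  ultimately show ?thesis unfolding contains_spindle_def using p by blast
qed

lemma wheel_embedding:
  assumes G: "pair_graph G" and hole: "hole (\<lambda>x y. (x, y) \<in> parcs G) n c"
    and hub: "\<And>i. (v, c i) \<in> parcs G" and n: "odd n" "3 \<le> n"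
  shows "contains_odd_wheel G"
proof -
  interpret G: pair_graph G by (rule G)
  define N where "N = nat n"
  have nN: "n = int N" using n by (simp add: N_def)
  define f where "f = case_option v (\<lambda>i. c (int i))"
  have f: "f None = v" "f (Some i) = c (int i)" for i by (simp_all add: f_def)
  have vc: "v \<noteq> c i" for i using hub[of i] G.no_loops' by blast
  have small: "\<not> n dvd k" if "k \<noteq> 0" "\<bar>k\<bar> < n" for k using dvd_imp_le_int[of k n] that by auto
  have cc: "c (int i) = c (int j) \<longleftrightarrow> i = j" if "i < N" "j < N" for i j
  proof
    assume "c (int i) = c (int j)"
    then have "n dvd int i - int j" using hole by (simp add: hole_def)
    moreover have "\<bar>int i - int j\<bar> < n" using that nN by simp
    ultimately show "i = j" using small[of "int i - int j"] by auto
  qed simp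
  have cE: "(c (int i), c (int j)) \<in> parcs G \<longleftrightarrow> j = (i + 1) mod N \<or> i = (j + 1) mod N"
    if ij: "i < N" "j < N" for i j
  proof -
    have *: "n dvd int a - int b + 1 \<longleftrightarrow> b = (a + 1) mod N" if "a < N" "b < N" for a b
    proof (cases "a + 1 = N")
      case True
      have "int a - int b + 1 = n - int b" using True nN by simp
      moreover have "n dvd n - int b \<longleftrightarrow> b = 0"
        using dvd_diff_right_iff[of n n "int b"] small[of "int b"] that nN by (cases "b = 0") auto
      ultimately have "n dvd int a - int b + 1 \<longleftrightarrow> b = 0" by metis
      moreover have "(a + 1) mod N = 0" using True by simp
      ultimately show ?thesis by (simp only:)
    next
      case False
      then have "(a + 1) mod N = a + 1" using that by simp
      moreover have "n dvd int a - int b + 1 \<longleftrightarrow> b = a + 1"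
        using small[of "int a - int b + 1"] that False nN by (cases "b = a + 1") auto
      ultimately show ?thesis by simp
    qed
    have "n dvd int i - int j - 1 \<longleftrightarrow> n dvd int j - int i + 1"
      using dvd_minus_iff[of n "int i - int j - 1"] by (simp add: algebra_simps)
    then show ?thesis using hole *[OF ij] *[OF ij(2,1)] by (auto simp: hole_def)
  qed
  have "contains_induced G (wheel N)" unfolding wheel_def
  proof (rule contains_inducedI[OF G, of _ _ f])
    show "{(Some i, Some ((i + 1) mod N)) |i. i < N} \<union> {(None, Some i) |i. i < N}
        \<subseteq> insert None (Some ` {..<N}) \<times> insert None (Some ` {..<N})" by auto
    show "inj_on f (insert None (Some ` {..<N}))"
      using vc cc by (auto simp: inj_on_def f eq_commute[of "c _" v])
    show "f ` insert None (Some ` {..<N}) \<subseteq> pverts G"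
      using hub[THEN G.in_arcsD1] hub[THEN G.in_arcsD2] by (auto simp: f)
  next
    fix x y assume xy: "x \<in> insert None (Some ` {..<N})" "y \<in> insert None (Some ` {..<N})"
    have hub': "(c i, v) \<in> parcs G" for i using hub G.arcs_symmetric by blast
    have vv: "(v, v) \<notin> parcs G" using G.no_loops' by blast
    show "((x, y) \<in> {(Some i, Some ((i + 1) mod N)) |i. i < N} \<union> {(None, Some i) |i. i < N} \<or>
        (y, x) \<in> {(Some i, Some ((i + 1) mod N)) |i. i < N} \<union> {(None, Some i) |i. i < N}) \<longleftrightarrow>
        (f x, f y) \<in> parcs G"
    proof (cases x)
      case None
      then show ?thesis using xy hub vv by (cases y) (auto simp: f)
    next
      case (Some i)
      then show ?thesis using xy hub' cE[of i] by (cases y) (auto simp: f)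
    qed
  qed
  moreover obtain t where "N = 2 * t + 1" using n nN by (metis even_of_nat oddE)
  moreover from this have "1 \<le> t" using n nN by simp
  ultimately show ?thesis unfolding contains_odd_wheel_def by blast
qed

lemma bull_embedding:
  assumes G: "pair_graph G" and E: "\<And>x y. E x y \<longleftrightarrow> (x, y) \<in> parcs G"
    and pos: "E x a" "E a c" "E c b" "E b y" "E a b"
    and neg: "\<not> E x c" "\<not> E x b" "\<not> E x y" "\<not> E a y" "\<not> E c y"
  shows "contains_induced G (bull)"
proof -
  interpret G: pair_graph G by (rule G)
  have sym: "E q p" if "E p q" for p q using that unfolding E by (rule G.arcs_symmetric)
  have irr: "\<not> E p p" for p unfolding E using G.no_loops' by blast
  note pos' = pos[THEN sym]
  have neg': "\<not> E c x" "\<not> E b x" "\<not> E y x" "\<not> E y a" "\<not> E y c"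
    using neg sym by blast+
  have ne: "x \<noteq> a" "x \<noteq> c" "x \<noteq> b" "x \<noteq> y" "a \<noteq> c" "a \<noteq> b" "a \<noteq> y" "c \<noteq> b" "c \<noteq> y" "b \<noteq> y"
    using pos neg pos' neg' irr by metis+
  have V: "{1..5} = {1, 2, 3, 4, 5 :: nat}" by auto
  note tgt = bull_def V
  \<comment> \<open>The vertices of the bull start at 1, so entry 0 is padding.\<close>
  define f where "f = (!) [x, x, a, c, b, y]"
  have f: "f 1 = x" "f (Suc 0) = x" "f 2 = a" "f 3 = c" "f 4 = b" "f 5 = y" by (simp_all add: f_def)
  show ?thesis unfolding tgt
  proof (rule contains_inducedI[OF G, of _ _ f])
    show "inj_on f {1, 2, 3, 4, 5}"
      using ne by (simp add: f ne[symmetric])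
    show "f ` {1, 2, 3, 4, 5} \<subseteq> pverts G"
      using pos[unfolded E, THEN G.in_arcsD1] pos[unfolded E, THEN G.in_arcsD2] by (simp add: f)
    show "(u, v) \<in> {(1, 2), (2, 3), (3, 4), (4, 5), (2, 4)} \<or>
        (v, u) \<in> {(1, 2), (2, 3), (3, 4), (4, 5), (2, 4)} \<longleftrightarrow> (f u, f v) \<in> parcs G"
      if "u \<in> {1, 2, 3, 4, 5}" "v \<in> {1, 2, 3, 4, 5}" for u v
      using that unfolding E[symmetric]
      by (elim insertE emptyE) (simp_all add: f pos pos' neg neg' irr)
  qed auto
qed

lemma C5_embedding:
  assumes G: "pair_graph G" and E: "\<And>x y. E x y \<longleftrightarrow> (x, y) \<in> parcs G"
    and pos: "E a b" "E b c" "E c d" "E d e" "E e a"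
    and neg: "\<not> E a c" "\<not> E a d" "\<not> E b d" "\<not> E b e" "\<not> E c e"
  shows "contains_induced G (cycle_graph 5)"
proof -
  interpret G: pair_graph G by (rule G)
  have sym: "E q p" if "E p q" for p q using that unfolding E by (rule G.arcs_symmetric)
  have irr: "\<not> E p p" for p unfolding E using G.no_loops' by blast
  note pos' = pos[THEN sym]
  have neg': "\<not> E c a" "\<not> E d a" "\<not> E d b" "\<not> E e b" "\<not> E e c"
    using neg sym by blast+
  have ne: "a \<noteq> b" "a \<noteq> c" "a \<noteq> d" "a \<noteq> e" "b \<noteq> c" "b \<noteq> d" "b \<noteq> e" "c \<noteq> d" "c \<noteq> e" "d \<noteq> e"
    using pos neg pos' neg' irr by metis+
  have V: "{..<5} = {0, 1, 2, 3, 4 :: nat}" by auto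
  have "{(i, (i + 1) mod 5) | i. i < 5} = (\<lambda>i. (i, (i + 1) mod 5)) ` {..<5 :: nat}" by blast
  also have "\<dots> = {(0, 1), (1, 2), (2, 3), (3, 4), (4, 0)}" unfolding V by (simp add: numeral_2_eq_2)
  finally have "{(i, (i + 1) mod 5) | i. i < 5} = {(0, 1), (1, 2), (2, 3), (3, 4), (4, 0 :: nat)}" .
  note tgt = cycle_graph_def V this
  define f where "f = (!) [a, b, c, d, e]"
  have f: "f 0 = a" "f 1 = b" "f (Suc 0) = b" "f 2 = c" "f 3 = d" "f 4 = e" by (simp_all add: f_def)
  show ?thesis unfolding tgt
  proof (rule contains_inducedI[OF G, of _ _ f])
    show "inj_on f {0, 1, 2, 3, 4}"
      using ne by (simp add: f ne[symmetric])
    show "f ` {0, 1, 2, 3, 4} \<subseteq> pverts G"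
      using pos[unfolded E, THEN G.in_arcsD1] pos[unfolded E, THEN G.in_arcsD2] by (simp add: f)
    show "(u, v) \<in> {(0, 1), (1, 2), (2, 3), (3, 4), (4, 0)} \<or>
        (v, u) \<in> {(0, 1), (1, 2), (2, 3), (3, 4), (4, 0)} \<longleftrightarrow> (f u, f v) \<in> parcs G"
      if "u \<in> {0, 1, 2, 3, 4}" "v \<in> {0, 1, 2, 3, 4}" for u v
      using that unfolding E[symmetric]
      by (elim insertE emptyE) (simp_all add: f pos pos' neg neg' irr)
  qed auto
qed

lemma S113_embedding:
  assumes G: "pair_graph G" and E: "\<And>x y. E x y \<longleftrightarrow> (x, y) \<in> parcs G"
    and pos: "E x l" "E x p" "E x r" "E r s" "E s t"
    and neg: "\<not> E x s" "\<not> E x t" "\<not> E l p" "\<not> E l r" "\<not> E l s" "\<not> E l t" "\<not> E p r" "\<not> E p s"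
      "\<not> E p t" "\<not> E r t"
    and lp: "l \<noteq> p"
  shows "contains_induced G (S_graph 1 1 3)"
proof -
  interpret G: pair_graph G by (rule G)
  have sym: "E q p" if "E p q" for p q using that unfolding E by (rule G.arcs_symmetric)
  have irr: "\<not> E p p" for p unfolding E using G.no_loops' by blast
  note pos' = pos[THEN sym]
  have neg': "\<not> E s x" "\<not> E t x" "\<not> E p l" "\<not> E r l" "\<not> E s l" "\<not> E t l" "\<not> E r p" "\<not> E s p"
    "\<not> E t p" "\<not> E t r"
    using neg sym by blast+
  have ne: "x \<noteq> l" "x \<noteq> p" "x \<noteq> r" "x \<noteq> s" "x \<noteq> t" "l \<noteq> p" "l \<noteq> r" "l \<noteq> s" "l \<noteq> t" "p \<noteq> r" "p \<noteq> s"
    "p \<noteq> t" "r \<noteq> s" "r \<noteq> t" "s \<noteq> t"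
    using pos neg pos' neg' irr lp by metis+
  note tgt = S_graph_113
  define f where
    "f = (\<lambda>(a :: nat, m :: nat). if a = 0 then x else if a = 1 then l else if a = 2 then p else [x, r, s, t] ! m)"
  have f: "f (0, 0) = x" "f (1, 1) = l" "f (Suc 0, Suc 0) = l" "f (2, 1) = p" "f (2, Suc 0) = p"
    "f (3, 1) = r" "f (3, Suc 0) = r" "f (3, 2) = s" "f (3, 3) = t" by (simp_all add: f_def)
  show ?thesis unfolding tgt
  proof (rule contains_inducedI[OF G, of _ _ f])
    show "inj_on f {(0, 0), (1, 1), (2, 1), (3, 1), (3, 2), (3, 3)}"
      using ne by (simp add: f ne[symmetric])
    show "f ` {(0, 0), (1, 1), (2, 1), (3, 1), (3, 2), (3, 3)} \<subseteq> pverts G"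
      using pos[unfolded E, THEN G.in_arcsD1] pos[unfolded E, THEN G.in_arcsD2] by (simp add: f)
    show "(u, v) \<in> {((0, 0), (1, 1)), ((0, 0), (2, 1)), ((0, 0), (3, 1)), ((3, 1), (3, 2)), ((3, 2), (3, 3))} \<or>
        (v, u) \<in> {((0, 0), (1, 1)), ((0, 0), (2, 1)), ((0, 0), (3, 1)), ((3, 1), (3, 2)), ((3, 2), (3, 3))} \<longleftrightarrow> (f u, f v) \<in> parcs G"
      if "u \<in> {(0, 0), (1, 1), (2, 1), (3, 1), (3, 2), (3, 3)}"
        "v \<in> {(0, 0), (1, 1), (2, 1), (3, 1), (3, 2), (3, 3)}" for u v
      using that unfolding E[symmetric]
      by (elim insertE emptyE) (simp_all add: f pos pos' neg neg' irr)
  qed auto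
qed

lemma S123_embedding:
  assumes G: "pair_graph G" and E: "\<And>x y. E x y \<longleftrightarrow> (x, y) \<in> parcs G"
    and pos: "E x l" "E x p" "E x r" "E p q" "E r s" "E s t"
    and neg: "\<not> E x q" "\<not> E x s" "\<not> E x t" "\<not> E l p" "\<not> E l q" "\<not> E l r" "\<not> E l s" "\<not> E l t"
      "\<not> E p r" "\<not> E p s" "\<not> E p t" "\<not> E q r" "\<not> E q s" "\<not> E q t" "\<not> E r t"
  shows "contains_induced G (S_graph 1 2 3)"
proof -
  interpret G: pair_graph G by (rule G)
  have sym: "E q p" if "E p q" for p q using that unfolding E by (rule G.arcs_symmetric)
  have irr: "\<not> E p p" for p unfolding E using G.no_loops' by blast
  note pos' = pos[THEN sym]
  have neg': "\<not> E q x" "\<not> E s x" "\<not> E t x" "\<not> E p l" "\<not> E q l" "\<not> E r l" "\<not> E s l" "\<not> E t l"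
    "\<not> E r p" "\<not> E s p" "\<not> E t p" "\<not> E r q" "\<not> E s q" "\<not> E t q" "\<not> E t r"
    using neg sym by blast+
  have ne: "x \<noteq> l" "x \<noteq> p" "x \<noteq> q" "x \<noteq> r" "x \<noteq> s" "x \<noteq> t" "l \<noteq> p" "l \<noteq> q" "l \<noteq> r" "l \<noteq> s" "l \<noteq> t"
    "p \<noteq> q" "p \<noteq> r" "p \<noteq> s" "p \<noteq> t" "q \<noteq> r" "q \<noteq> s" "q \<noteq> t" "r \<noteq> s" "r \<noteq> t" "s \<noteq> t"
    using pos neg pos' neg' irr by metis+
  note tgt = S_graph_123
  define f where
    "f = (\<lambda>(a :: nat, m :: nat). if a = 0 then x else if a = 1 then l else if a = 2 then [x, p, q] ! m else [x, r, s, t] ! m)"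
  have f: "f (0, 0) = x" "f (1, 1) = l" "f (Suc 0, Suc 0) = l" "f (2, 1) = p" "f (2, Suc 0) = p"
    "f (2, 2) = q" "f (3, 1) = r" "f (3, Suc 0) = r" "f (3, 2) = s" "f (3, 3) = t" by (simp_all
    add: f_def)
  show ?thesis unfolding tgt
  proof (rule contains_inducedI[OF G, of _ _ f])
    show "inj_on f {(0, 0), (1, 1), (2, 1), (2, 2), (3, 1), (3, 2), (3, 3)}"
      using ne by (simp add: f ne[symmetric])
    show "f ` {(0, 0), (1, 1), (2, 1), (2, 2), (3, 1), (3, 2), (3, 3)} \<subseteq> pverts G"
      using pos[unfolded E, THEN G.in_arcsD1] pos[unfolded E, THEN G.in_arcsD2] by (simp add: f)
    show "(u, v) \<in> {((0, 0), (1, 1)), ((0, 0), (2, 1)), ((0, 0), (3, 1)), ((2, 1), (2, 2)), ((3, 1), (3, 2)), ((3, 2), (3, 3))} \<or>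
        (v, u) \<in> {((0, 0), (1, 1)), ((0, 0), (2, 1)), ((0, 0), (3, 1)), ((2, 1), (2, 2)), ((3, 1), (3, 2)), ((3, 2), (3, 3))} \<longleftrightarrow> (f u, f v) \<in> parcs G"
      if "u \<in> {(0, 0), (1, 1), (2, 1), (2, 2), (3, 1), (3, 2), (3, 3)}"
        "v \<in> {(0, 0), (1, 1), (2, 1), (2, 2), (3, 1), (3, 2), (3, 3)}" for u v
      using that unfolding E[symmetric]
      by (elim insertE emptyE) (simp_all add: f pos pos' neg neg' irr)
  qed auto
qed

lemma critical_subset:
  assumes "finite V" "\<not> col_on E k V"
  obtains U where "U \<subseteq> V" "\<not> col_on E k U" "\<And>W. W \<subset> U \<Longrightarrow> col_on E k W"
proof -
  define P where "P U \<longleftrightarrow> U \<subseteq> V \<and> \<not> col_on E k U" for U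
  have "P V" using assms(2) by (simp add: P_def)
  define U where "U = arg_min card P"
  have U: "P U" unfolding U_def by (rule arg_min_natI[of P, OF \<open>P V\<close>])
  have min: "card U \<le> card W" if "P W" for W
    unfolding U_def by (rule arg_min_nat_le[of P, OF that])
  have "col_on E k W" if "W \<subset> U" for W
  proof (rule ccontr)
    assume "\<not> col_on E k W"
    then have "P W" using that U unfolding P_def by blast
    moreover have "finite U" using U assms(1) unfolding P_def by (blast intro: finite_subset)
    then have "card W < card U" using that by (rule psubset_card_mono)
    ultimately show False using min[of W] by simp
  qed
  moreover have "U \<subseteq> V" "\<not> col_on E k U" using U by (simp_all add: P_def)
  ultimately show ?thesis by (intro that[of U])
qed

theorem theorem4:
  fixes G :: "'a pair_pre_digraph"
    and H :: "(nat \<times> nat) pair_pre_digraph"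
  assumes "H \<in> {S_graph 1 1 3, S_graph 1 2 3}"
    and "pair_graph G"
    and "connected (with_proj G)"
    and "\<not> contains_induced G bull"
    and "\<not> contains_induced G (cycle_graph 5)"
    and "\<not> contains_induced G H"
  shows "contains_odd_wheel G \<or> contains_spindle G \<or> colourable 3 G"
proof (rule ccontr)
  assume "\<not> ?thesis"
  then have no_wheel: "\<not> contains_odd_wheel G" and no_spindle: "\<not> contains_spindle G"
    and "\<not> colourable 3 G" by blast+
  interpret G: pair_graph G by (rule assms(2))
  define A where "A x y \<longleftrightarrow> (x, y) \<in> parcs G" for x y
  have Asym: "A x y \<Longrightarrow> A y x" for x y unfolding A_def by (rule G.arcs_symmetric)
  have "\<not> col_on A 3 (pverts G)"
  proof
    assume "col_on A 3 (pverts G)"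
    then obtain f :: "'a \<Rightarrow> nat" where f: "\<forall>x\<in>pverts G. f x < 3"
      "\<forall>x\<in>pverts G. \<forall>y\<in>pverts G. A x y \<longrightarrow> f x \<noteq> f y" unfolding col_on_def by blast
    then have "\<forall>(u, v) \<in> parcs G. f u \<noteq> f v"
      using G.in_arcsD1 G.in_arcsD2 unfolding A_def by fast
    then show False using f(1) \<open>\<not> colourable 3 G\<close> unfolding colourable_def by blast
  qed
  then obtain U where U: "U \<subseteq> pverts G" "\<not> col_on A 3 U" "\<And>W. W \<subset> U \<Longrightarrow> col_on A 3 W"
    using critical_subset[OF G.pair_finite_verts] by blast
  \<comment> \<open>Cutting the adjacency down to \<open>U\<close> confines all edges to
    \<open>U\<close>, as \<open>critical\<close> demands, without changing anything inside
    \<open>U\<close>.\<close>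
  define E where "E x y \<longleftrightarrow> x \<in> U \<and> y \<in> U \<and> A x y" for x y
  have EA: "A x y \<longleftrightarrow> E x y" if "x \<in> U" "y \<in> U" for x y using that by (simp add: E_def)
  have col: "col_on E 3 W \<longleftrightarrow> col_on A 3 W" if "W \<subseteq> U" for W
  proof -
    have "(\<forall>x\<in>W. \<forall>y\<in>W. E x y \<longrightarrow> f x \<noteq> f y) \<longleftrightarrow> (\<forall>x\<in>W. \<forall>y\<in>W. A x y \<longrightarrow> f x \<noteq> f y)"
      for f :: "'a \<Rightarrow> nat"
      using that unfolding E_def by blast
    then show ?thesis unfolding col_on_def by simp
  qed
  have Ein: "x \<in> U" "y \<in> U" if "E x y" for x y using that by (simp_all add: E_def)
  have E_G: "(x, y) \<in> parcs G" if "E x y" for x y using that by (simp add: E_def A_def)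
  have sym: "E y x" if "E x y" for x y using that Asym by (simp add: E_def)
  interpret critical_S U E
  proof
    show "finite U" using U(1) G.pair_finite_verts finite_subset by blast
    show "\<not> E x x" for x using G.no_loops' by (auto simp: E_def A_def)
    show "\<not> col_on E 3 U" using col U by blast
    show "col_on E 3 W" if "W \<subset> U" for W using col U that by blast
  next
    fix a b c x y
    assume h: "E a b" "E b c" "E a c" "E x a" "\<not> E x b" "\<not> E x c" "E y b" "\<not> E y a" "\<not> E y c"
    note m = Ein[OF h(1)] Ein[OF h(2)] Ein[OF h(4)] Ein[OF h(7)]
    show "E x y"
    proof (rule ccontr)
      assume "\<not> E x y"
      then have "contains_induced G bull"
        using h m sym by (intro bull_embedding[OF assms(2) A_def, of x a c b y]) (simp_all add: EA,
          blast+)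
      then show False using assms(4) by contradiction
    qed
  next
    fix a b c d e
    assume h: "E a b" "E b c" "E c d" "E d e" "E e a" "\<not> E a c" "\<not> E b d" "\<not> E c e" "\<not> E d a"
    note m = Ein[OF h(1)] Ein[OF h(3)] Ein[OF h(5)]
    show "E e b"
    proof (rule ccontr)
      assume "\<not> E e b"
      then have "contains_induced G (cycle_graph 5)"
        using h m sym by (intro C5_embedding[OF assms(2) A_def, of a b c d e]) (simp_all add: EA,
          blast+)
      then show False using assms(5) by contradiction
    qed
  next
    fix p and u :: "nat \<Rightarrow> 'a"
    assume h: "1 \<le> p" "inj_on u {..3 * p}" "\<And>k. k < p \<Longrightarrow> E (u (3 * k)) (u (3 * k + 1)) \<and> E (u (3 * k)) (u (3 * k + 2)) \<and>
        E (u (3 * k + 1)) (u (3 * k + 2)) \<and> E (u (3 * k + 1)) (u (3 * k + 3)) \<and>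
        E (u (3 * k + 2)) (u (3 * k + 3))"
    show "\<not> E (u (3 * p)) (u 0)"
    proof
      assume "E (u (3 * p)) (u 0)"
      then have "contains_spindle G"
        using h by (intro contains_spindleI[OF assms(2) h(1,2)]) (auto intro!: E_G)
      then show False using no_spindle by contradiction
    qed
  next
    fix x l p q r s t
    assume h: "E x l" "E x p" "E p q" "E x r" "E r s" "E s t" "\<not> E l p" "\<not> E l q" "\<not> E l r"
      "\<not> E l s"
      "\<not> E l t" "\<not> E x q" "\<not> E x s" "\<not> E x t" "\<not> E p r" "\<not> E p s" "\<not> E p t" "\<not> E q r" "\<not> E q s"
        "\<not> E q t"
    note m = Ein[OF h(1)] Ein[OF h(3)] Ein[OF h(5)] Ein[OF h(6)]
    have "l \<noteq> p" using h by blast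
    show "E r t"
    proof (rule ccontr)
      assume "\<not> E r t"
      \<comment> \<open>Dropping \<open>q\<close> from the copy of S_{1,2,3} leaves one of
        S_{1,1,3}, so both choices of \<open>H\<close> are contradicted.\<close>
      have "contains_induced G (S_graph 1 1 3)"
        using h m sym \<open>\<not> E r t\<close> \<open>l \<noteq> p\<close>
        by (intro S113_embedding[OF assms(2) A_def, of x l p r s t]) (simp_all add: EA)
      moreover have "contains_induced G (S_graph 1 2 3)"
        using h m sym \<open>\<not> E r t\<close>
        by (intro S123_embedding[OF assms(2) A_def, of x l p r q s t]) (simp_all add: EA)
      ultimately show False using assms(1,6) by auto
    qed
  next
    fix n c v
    assume h: "hole E n c" "odd n" "3 \<le> n"
    show "\<exists>i. \<not> E v (c i)"
    proof (rule ccontr)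
      assume hub: "\<nexists>i. \<not> E v (c i)"
      then have cU: "c i \<in> U" for i using Ein by blast
      have "hole (\<lambda>x y. (x, y) \<in> parcs G) n c"
        using h(1) EA[OF cU cU] unfolding hole_def A_def by simp
      then have "contains_odd_wheel G"
        by (rule wheel_embedding[OF assms(2) _ _ h(2,3)]) (use hub E_G in blast)
      then show False using no_wheel by contradiction
    qed
  qed (fact Ein(1) sym)+
  interpret critical_bip U E
    by unfold_locales (rule bipartite_if_triangle_free)
  show False by (rule no_critical_bip)
qed

end
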